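(* Let $\Phi=\bigcap_{x\in X}B(x,h)\subset\mathbb{R}^3$ be a Reuleaux polyhedron. Let $\Sigma(\Phi)$ be the surface obtained from $\partial\Phi$ by choosing one edge from each pair of dual edges of $G_\Phi$ and performing surgery on each chosen edge. Then $\Sigma(\Phi)$ is the boundary of a convex body of constant width $h$.
   Context: $B(x,h)$, $S(x,h)$ denote the closed ball and sphere of radius $h$ centered at $x$. A ball polyhedron in $\mathbb{R}^3$ is a finite intersection (at least $3$) of closed balls of radius $h>0$; for $\Phi=\bigcap_{x\in X}B(x,h)$ with nonempty interior and no redundant ball, a boundary point $y$ is $0$-singular if there are $x_1,x_2,x_3\in X\cap S(y,h)$ with $x_1-y,x_2-y,x_3-y$ linearly independent. The singular boundary points form an embedded graph $G_\Phi$ whose vertices are the $0$-singular points and whose edges are circular arcs $\widetilde{ab}$ joining pairs of vertices; the faces of $\Phi$ are the sets $\tau(x)=S(x,h)\cap\Phi$, $x\in X$. $\Phi$ is standard if any two faces intersect in the empty set, a single vertex or a single edge. A Reuleaux polyhedron is a standard ball polyhedron $\bigcap_{x\in X}B(x,h)$ whose set of $0$-singular boundary points is exactly $X$. In a Reuleaux polyhedron, each edge $\widetilde{xy}$ (with endpoints $x,y\in X$) has a dual edge $\widetilde{ab}$, where $a,b\in X$ are such that $\widetilde{xy}=\tau(a)\cap\tau(b)$; then $d(x,a)=d(x,b)=d(y,a)=d(y,b)=h$, $\widetilde{xy}\subset S(a,h)\cap S(b,h)$ and $\widetilde{ab}\subset S(x,h)\cap S(y,h)$; $\{\widetilde{xy},\widetilde{ab}\}$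 is a pair of dual edges. Surgery on the edge $\widetilde{xy}$ with dual edge $\widetilde{ab}$: let $\Sigma_a\subset S(a,h)$ and $\Sigma_b\subset S(b,h)$ be the shortest geodesics joining $x$ and $y$ on these spheres; let $\Sigma(xy)$ be the region of $\partial\Phi$ between $\Sigma_a$ and $\Sigma_b$ (containing $\widetilde{xy}$); let the wedge $W(x,y)$ be the surface of revolution with axis the line through $x,y$ lying between $\Sigma_a$ and $\Sigma_b$, i.e. the union of the shorter circular arcs of radius $h$ from $x$ to $y$ whose centers are points of $\widetilde{ab}$. Surgery replaces $\Sigma(xy)$ by $W(x,y)$ in the boundary. A convex body has constant width $h$ if the distance between every pair of parallel supporting planes is $h$. *)

theory Defs
  imports "HOL-Analysis.Analysis"
begin

type_synonym pt = "real^3"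

definition bpoly :: "pt set \<Rightarrow> real \<Rightarrow> pt set" where
  "bpoly X h = (\<Inter>x\<in>X. cball x h)"

definition ball_polyhedron :: "pt set \<Rightarrow> real \<Rightarrow> bool" where
  "ball_polyhedron X h \<longleftrightarrow> finite X \<and> card X \<ge> 3 \<and> h > 0
     \<and> interior (bpoly X h) \<noteq> {}
     \<and> (\<forall>x\<in>X. bpoly (X - {x}) h \<noteq> bpoly X h)"

definition bface :: "pt set \<Rightarrow> real \<Rightarrow> pt \<Rightarrow> pt set" where
  "bface X h x = sphere x h \<inter> bpoly X h"

definition vertices :: "pt set \<Rightarrow> real \<Rightarrow> pt set" where
  "vertices X h = {y \<in> frontier (bpoly X h). \<exists>x1 x2 x3.
      x1 \<in> X \<inter> sphere y h \<and> x2 \<in> X \<inter> sphere y h \<and> x3 \<in> X \<inter> sphere y h \<and>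
      card {x1 - y, x2 - y, x3 - y} = 3 \<and> independent {x1 - y, x2 - y, x3 - y}}"

definition circ_arc :: "pt set \<Rightarrow> pt \<Rightarrow> pt \<Rightarrow> bool" where
  "circ_arc A p q \<longleftrightarrow> (\<exists>c r u v \<theta>. r > 0 \<and> u \<bullet> u = 1 \<and> v \<bullet> v = 1 \<and> u \<bullet> v = 0 \<and>
      0 < \<theta> \<and> \<theta> < 2 * pi \<and>
      A = {c + r *\<^sub>R (cos t *\<^sub>R u + sin t *\<^sub>R v) | t. t \<in> {0..\<theta>}} \<and>
      p = c + r *\<^sub>R u \<and> q = c + r *\<^sub>R (cos \<theta> *\<^sub>R u + sin \<theta> *\<^sub>R v))"

definition is_edge :: "pt set \<Rightarrow> real \<Rightarrow> pt set \<Rightarrow> bool" where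
  "is_edge X h A \<longleftrightarrow> (\<exists>p q. p \<noteq> q \<and> circ_arc A p q \<and> A \<inter> vertices X h = {p, q})"

definition standard :: "pt set \<Rightarrow> real \<Rightarrow> bool" where
  "standard X h \<longleftrightarrow> (\<forall>a\<in>X. \<forall>b\<in>X. a \<noteq> b \<longrightarrow>
      bface X h a \<inter> bface X h b = {} \<or>
      (\<exists>v\<in>vertices X h. bface X h a \<inter> bface X h b = {v}) \<or>
      is_edge X h (bface X h a \<inter> bface X h b))"

definition reuleaux_polyhedron :: "pt set \<Rightarrow> real \<Rightarrow> bool" where
  "reuleaux_polyhedron X h \<longleftrightarrow> ball_polyhedron X h \<and> standard X h \<and> vertices X h = X"

text \<open>Edges are indexed by the pair of faces \<open>{a,b}\<close> they lie in: the edge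
  \<open>\<tau>(a) \<inter> \<tau>(b)\<close>.\<close>
definition edge_set :: "pt set \<Rightarrow> real \<Rightarrow> pt set \<Rightarrow> pt set" where
  "edge_set X h l = (\<Inter>a\<in>l. bface X h a)"

definition edge_labels :: "pt set \<Rightarrow> real \<Rightarrow> pt set set" where
  "edge_labels X h = {{a, b} | a b. a \<in> X \<and> b \<in> X \<and> a \<noteq> b \<and> is_edge X h (bface X h a \<inter> bface X h b)}"

definition endpoints :: "pt set \<Rightarrow> real \<Rightarrow> pt set \<Rightarrow> pt set" where
  "endpoints X h l = edge_set X h l \<inter> vertices X h"

text \<open>Dual of the edge \<open>\<tau>(a)\<inter>\<tau>(b)\<close> with endpoints \<open>x,y\<close> is \<open>\<tau>(x)\<inter>\<tau>(y)\<close>, label \<open>{x,y}\<close>.\<close>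
abbreviation dual_label :: "pt set \<Rightarrow> real \<Rightarrow> pt set \<Rightarrow> pt set" where
  "dual_label X h l \<equiv> endpoints X h l"

text \<open>Shorter circular arc of radius \<open>r\<close> centred at \<open>c\<close> from \<open>x\<close> to \<open>y\<close>
  (for \<open>|x-c| = |y-c| = r\<close> this is the shortest geodesic on \<open>S(c,r)\<close>).\<close>
definition minor_arc :: "pt \<Rightarrow> real \<Rightarrow> pt \<Rightarrow> pt \<Rightarrow> pt set" where
  "minor_arc c r x y = {c + r *\<^sub>R sgn ((1 - t) *\<^sub>R (x - c) + t *\<^sub>R (y - c)) | t. t \<in> {0..1}}"

text \<open>The region \<open>\<Sigma>(xy)\<close> of \<open>\<partial>\<Phi>\<close> between \<open>\<Sigma>_a\<close> and \<open>\<Sigma>_b\<close> containing the edge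
  with label \<open>l = {a,b}\<close> and endpoints \<open>{x,y}\<close>.\<close>
definition surgery_region :: "pt set \<Rightarrow> real \<Rightarrow> pt set \<Rightarrow> pt set" where
  "surgery_region X h l =
     (let d = endpoints X h l;
          \<Gamma> = \<Union>{minor_arc c h x y | c x y. c \<in> l \<and> x \<in> d \<and> y \<in> d \<and> x \<noteq> y}
      in closure (\<Union>{connected_component_set (frontier (bpoly X h) - \<Gamma>) p | p.
                     p \<in> edge_set X h l - d}))"

definition wedge :: "pt set \<Rightarrow> real \<Rightarrow> pt set \<Rightarrow> pt set" where
  "wedge X h l =
     (let d = endpoints X h l
      in \<Union>{minor_arc c h x y | c x y. c \<in> edge_set X h d \<and> x \<in> d \<and> y \<in> d \<and> x \<noteq> y})"

definition surgered :: "pt set \<Rightarrow> real \<Rightarrow> pt set set \<Rightarrow> pt set" where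
  "surgered X h C = (frontier (bpoly X h) - (\<Union>l\<in>C. surgery_region X h l)) \<union> (\<Union>l\<in>C. wedge X h l)"

definition constant_width :: "pt set \<Rightarrow> real \<Rightarrow> bool" where
  "constant_width K h \<longleftrightarrow> (\<forall>u. norm u = 1 \<longrightarrow>
      (SUP p\<in>K. u \<bullet> p) - (INF p\<in>K. u \<bullet> p) = h)"

definition convex_body :: "pt set \<Rightarrow> bool" where
  "convex_body K \<longleftrightarrow> convex K \<and> compact K \<and> interior K \<noteq> {}"

end

theory Submission
  imports Defs
begin

text \<open>
  Let \<open>E\<close> consist of \<open>X\<close> and the edges that are not operated on. The body is \<open>K = \<Inter>e\<in>E. B(e,h)\<close>.
  A compact set that is the intersection of the \<open>h\<close>-balls centred at its own points has constant
  width \<open>h\<close>, so the point is \<open>K = \<Inter>p\<in>K. B(p,h)\<close>. One inclusion is \<open>E \<subseteq> K\<close>, i.e. \<open>E\<close> has diameter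
  at most \<open>h\<close>: a point of \<open>\<partial>\<Phi>\<close> at distance more than \<open>h\<close> from a point of an edge lies in the
  interior of a lune next to the dual edge, where only the faces of the two lunes are active.
  For the other inclusion it suffices that \<open>K \<subseteq> B(p,h)\<close> for \<open>p \<in> \<partial>K\<close>, which holds as soon as
  \<open>p - c\<close> is a nonnegative combination of vectors \<open>e - c\<close>, where \<open>c\<close> and all \<open>e\<close> are in \<open>E\<close> and
  \<open>|p - c| = |e - c| = h\<close>. If \<open>c\<close> is an inner point of an edge, then \<open>p\<close> is forced onto the arc of
  the wedge with centre \<open>c\<close>. If \<open>c \<in> X\<close>, then \<open>p\<close> is on the face of \<open>c\<close> with the lunes cut off, and on
  a great circle through \<open>p\<close> one meets, on either side, a point of \<open>E\<close> or of a wedge.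
\<close>

section \<open>Intersections of balls and constant width\<close>

text \<open>Why one edge of each pair: points on two edges can be more than h apart only if the
  edges are dual to each other. As no dual pair has both its edges in E, the diameter of E is at
  most h; as every pair has one there, each edge that is not operated on supplies centres. The two
  directions of the equivalence for C serve these two purposes. Why cones: for |v| = h the condition
  K \<subseteq> B(a + v, h) reads |v| |z - a|^2 \<le> 2 h (z - a) \<bullet> v for all z in K, which
  is homogeneous and convex in v. Great circles on the sphere about a become straight lines of
  directions, and a direction between two good ones is good. Why coordinates: a and b are both at
  distance h from x and from y, so the lines ab and xy are perpendicular to each other and to the
  line joining the two midpoints. In the resulting frame, comparing balls centred on the dual edge
  is a linear matter. The region that surgery removes is given by connected components, so it has to
  be recognized topologically as a pair of lunes.\<close>

lemma bpoly_antimono: "S \<subseteq> T \<Longrightarrow> bpoly T h \<subseteq> bpoly S h"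
  by (auto simp: bpoly_def)

lemma mem_bpoly: "p \<in> bpoly S h \<longleftrightarrow> (\<forall>c\<in>S. dist c p \<le> h)"
  by (auto simp: bpoly_def)

lemma convex_bpoly: "convex (bpoly S h)"
  by (auto simp: bpoly_def intro!: convex_INT)

lemma compact_bpoly: "S \<noteq> {} \<Longrightarrow> compact (bpoly S h)"
  unfolding bpoly_def by (intro compact_Inter) auto

lemma closed_bpoly: "closed (bpoly S h)"
  unfolding bpoly_def by (intro closed_INT) auto

text \<open>\<open>E\<close> will contain whole arcs, so compactness replaces finiteness: a farthest
  centre exists, and the gap between its distance and \<open>h\<close> is the radius of a ball
  around \<open>p\<close>.\<close>

lemma frontier_bpoly:
  assumes E: "compact E"
  shows "frontier (bpoly E h) = {p \<in> bpoly E h. \<exists>c\<in>E. dist c p = h}"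
proof (intro equalityI subsetI)
  fix p assume "p \<in> frontier (bpoly E h)"
  then have p: "p \<in> bpoly E h" "p \<notin> interior (bpoly E h)"
    by (auto simp: frontier_def closed_bpoly)
  have "\<exists>c\<in>E. dist c p = h"
  proof (rule ccontr)
    assume "\<not> ?thesis"
    with p have lt: "c \<in> E \<Longrightarrow> dist c p < h" for c
      by (force simp: mem_bpoly)
    have "\<exists>e>0. ball p e \<subseteq> bpoly E h"
    proof (cases "E = {}")
      case True
      then show ?thesis by (intro exI[of _ 1]) (auto simp: bpoly_def)
    next
      case False
      have "continuous_on E (\<lambda>c. dist c p)" by (intro continuous_intros)
      from continuous_attains_sup[OF E False this]
      obtain c0 where c0: "c0 \<in> E" "\<And>c. c \<in> E \<Longrightarrow> dist c p \<le> dist c0 p" by blast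
      have "ball p (h - dist c0 p) \<subseteq> bpoly E h"
      proof
        fix q assume q: "q \<in> ball p (h - dist c0 p)"
        have "dist c q \<le> h" if "c \<in> E" for c
          using dist_triangle[of c q p] c0(2)[OF that] q by simp
        then show "q \<in> bpoly E h" by (simp add: mem_bpoly)
      qed
      then show ?thesis using lt[OF c0(1)] by (intro exI[of _ "h - dist c0 p"]) auto
    qed
    then show False using p(2) by (auto simp: mem_interior)
  qed
  with p show "p \<in> {p \<in> bpoly E h. \<exists>c\<in>E. dist c p = h}" by simp
next
  fix p assume "p \<in> {p \<in> bpoly E h. \<exists>c\<in>E. dist c p = h}"
  then obtain c where c: "p \<in> bpoly E h" "c \<in> E" "dist c p = h" by auto
  have "interior (bpoly E h) \<subseteq> interior (cball c h)"
    using c(2) by (intro interior_mono) (auto simp: bpoly_def)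
  with c(3) have "p \<notin> interior (bpoly E h)" by (auto simp: interior_cball)
  with c(1) show "p \<in> frontier (bpoly E h)" by (simp add: frontier_def closed_bpoly)
qed

text \<open>Stewart's formula. The last term is the strict convexity of the squared distance; it
  pays for the perturbation in \<open>constant_width_selfdual\<close> and gives strictness in
  \<open>thin_region_aux\<close>.\<close>

lemma dist_sq_affine:
  fixes p z c :: "'a::real_inner"
  shows "(dist (p + t *\<^sub>R (z - p)) c)\<^sup>2 = (1 - t) * (dist p c)\<^sup>2 + t * (dist z c)\<^sup>2 - t * (1 - t) * (dist z p)\<^sup>2"
proof -
  have "(dist (c + P + t *\<^sub>R (c + Z - (c + P))) c)\<^sup>2
      = (1 - t) * (dist (c + P) c)\<^sup>2 + t * (dist (c + Z) c)\<^sup>2 - t * (1 - t) * (dist (c + Z) (c + P))\<^sup>2" for P Z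
    by (simp add: dist_norm power2_norm_eq_inner algebra_simps inner_commute)
  from this[of "p - c" "z - c"] show ?thesis by simp
qed

text \<open>The homogeneous form of \<open>Z \<subseteq> cball (a + v) h\<close> (for \<open>norm v = h\<close>); by the triangle inequality
  it defines a convex cone.\<close>
definition support_cone :: "pt set \<Rightarrow> real \<Rightarrow> pt \<Rightarrow> pt set" where
  "support_cone Z h a = {v. \<forall>z\<in>Z. norm v * (dist z a)\<^sup>2 \<le> 2 * h * ((z - a) \<bullet> v)}"

lemma support_cone_add:
  assumes "v \<in> support_cone Z h a" "w \<in> support_cone Z h a"
  shows "v + w \<in> support_cone Z h a"
proof -
  have "norm (v + w) * (dist z a)\<^sup>2 \<le> 2 * h * ((z - a) \<bullet> (v + w))" if "z \<in> Z" for z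
  proof -
    have "norm (v + w) * (dist z a)\<^sup>2 \<le> (norm v + norm w) * (dist z a)\<^sup>2"
      by (intro mult_right_mono norm_triangle_ineq) auto
    also have "\<dots> \<le> 2 * h * ((z - a) \<bullet> v) + 2 * h * ((z - a) \<bullet> w)"
      using assms that by (auto simp: support_cone_def distrib_right intro!: add_mono)
    finally show ?thesis by (simp add: inner_add_right distrib_left)
  qed
  then show ?thesis by (simp add: support_cone_def)
qed

lemma support_cone_scale:
  assumes "v \<in> support_cone Z h a" "0 \<le> r"
  shows "r *\<^sub>R v \<in> support_cone Z h a"
proof -
  have "norm (r *\<^sub>R v) * (dist z a)\<^sup>2 \<le> 2 * h * ((z - a) \<bullet> (r *\<^sub>R v))" if "z \<in> Z" for z
  proof -
    have "r * (norm v * (dist z a)\<^sup>2) \<le> r * (2 * h * ((z - a) \<bullet> v))"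
      using assms that by (intro mult_left_mono) (auto simp: support_cone_def)
    then show ?thesis using assms(2) by (simp add: mult_ac)
  qed
  then show ?thesis by (simp add: support_cone_def)
qed

lemma dist_sq_expand:
  fixes z p a :: "'a::real_inner"
  shows "(dist z p)\<^sup>2 = (dist z a)\<^sup>2 - 2 * ((z - a) \<bullet> (p - a)) + (dist a p)\<^sup>2"
  by (simp add: dist_norm power2_norm_eq_inner algebra_simps inner_commute)

lemma support_cone_iff:
  assumes "h > 0" "dist a p = h"
  shows "p - a \<in> support_cone Z h a \<longleftrightarrow> Z \<subseteq> cball p h"
proof -
  have "norm (p - a) = h" using assms by (simp add: dist_norm norm_minus_commute)
  moreover have "dist p z \<le> h \<longleftrightarrow> (dist z a)\<^sup>2 \<le> 2 * ((z - a) \<bullet> (p - a))" for z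
  proof -
    have "dist p z \<le> h \<longleftrightarrow> (dist z p)\<^sup>2 \<le> h\<^sup>2"
      using abs_le_square_iff[of "dist z p" h] assms(1) by (simp add: dist_commute)
    then show ?thesis using dist_sq_expand[of z p a] assms(2) by simp
  qed
  ultimately show ?thesis
    using assms by (auto simp: support_cone_def subset_iff mult.assoc mult.left_commute[of 2 h])
qed

text \<open>If the antipode \<open>p - h *\<^sub>R u\<close> of a support point \<open>p\<close>
  were missing, some \<open>z\<close> in \<open>K\<close> would be too far from it. Moving
  \<open>p\<close> a little towards \<open>z\<close> and then outwards along \<open>u\<close> gives
  a point still within \<open>h\<close> of all of \<open>K\<close>, hence in \<open>K\<close>, but
  beyond the supporting plane. With antipodes present the width is at least \<open>h\<close>; the
  diameter bounds it above.\<close>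

lemma constant_width_selfdual:
  assumes K: "bpoly K h = K" "K \<noteq> {}" and h: "h > 0"
  shows "convex_body K \<and> constant_width K h"
proof -
  have cpt: "compact K" and cvx: "convex K"
    using compact_bpoly[OF K(2), of h] convex_bpoly[of K h] by (auto simp: K(1))
  have diam: "dist p q \<le> h" if "p \<in> K" "q \<in> K" for p q
    using that K(1) by (metis mem_bpoly)
  have antipode: "p - h *\<^sub>R u \<in> K"
    if u: "norm u = 1" and p: "p \<in> K" and max: "\<And>q. q \<in> K \<Longrightarrow> u \<bullet> q \<le> u \<bullet> p" for u p
  proof (rule ccontr)
    assume "p - h *\<^sub>R u \<notin> K"
    then obtain z where z: "z \<in> K" "dist z (p - h *\<^sub>R u) > h"
      using K(1) by (metis mem_bpoly not_le)
    define D where "D = dist z p"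
    have "h\<^sup>2 < (dist z (p - h *\<^sub>R u))\<^sup>2" using z(2) h by (intro power_strict_mono) auto
    also have "\<dots> = D\<^sup>2 + 2 * h * (u \<bullet> (z - p)) + h\<^sup>2"
      using dist_sq_expand[of z "p - h *\<^sub>R u" p] u
      by (simp add: D_def dist_norm inner_commute power_mult_distrib)
    finally have "- (u \<bullet> (z - p)) < D\<^sup>2 / (2 * h)" using h by (simp add: field_simps)
    \<comment> \<open>The lower bound lets the step outwards along \<open>u\<close> outweigh any
      loss in moving towards \<open>z\<close>; the upper bound keeps its cost
      \<open>2 * h * \<sigma>\<close> below the convexity gain \<open>D^2\<close>. Cutting off at 0
      afterwards preserves both.\<close>
    then obtain \<sigma>0 where s0: "- (u \<bullet> (z - p)) < \<sigma>0" "\<sigma>0 < D\<^sup>2 / (2 * h)" using dense by blast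
    define \<sigma> where "\<sigma> = max \<sigma>0 0"
    have Dpos: "D > 0"
      using z(2) h u by (cases "z = p") (auto simp: D_def dist_norm)
    have s: "- (u \<bullet> (z - p)) < \<sigma>" "2 * h * \<sigma> < D\<^sup>2" "0 \<le> \<sigma>"
      using s0 h Dpos by (auto simp: \<sigma>_def max_def field_simps)
    \<comment> \<open>Collecting terms, \<open>(dist w c)^2 - h^2\<close> will be at most
      \<open>t\<close> times \<open>2 * h * \<sigma> + t * (D^2 + \<sigma>^2) - D^2\<close>.\<close>
    have "\<exists>t>0. t \<le> 1 \<and> 2 * h * \<sigma> + t * (D\<^sup>2 + \<sigma>\<^sup>2) \<le> D\<^sup>2"
    proof -
      have "D\<^sup>2 + \<sigma>\<^sup>2 > 0" using Dpos by (simp add: add_pos_nonneg)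
      then have "min 1 ((D\<^sup>2 - 2 * h * \<sigma>) / (D\<^sup>2 + \<sigma>\<^sup>2)) * (D\<^sup>2 + \<sigma>\<^sup>2) \<le> D\<^sup>2 - 2 * h * \<sigma>"
        by (subst pos_le_divide_eq[symmetric]) auto
      with \<open>D\<^sup>2 + \<sigma>\<^sup>2 > 0\<close> s(2) show ?thesis
        by (intro exI[of _ "min 1 ((D\<^sup>2 - 2 * h * \<sigma>) / (D\<^sup>2 + \<sigma>\<^sup>2))"]) auto
    qed
    then obtain t where t: "0 < t" "t \<le> 1" "2 * h * \<sigma> + t * (D\<^sup>2 + \<sigma>\<^sup>2) \<le> D\<^sup>2" by blast
    define w where "w = p + t *\<^sub>R (z - p) + (t * \<sigma>) *\<^sub>R u"
    have "dist c w \<le> h" if c: "c \<in> K" for c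
    proof -
      define q where "q = p + t *\<^sub>R (z - p)"
      have q: "q \<in> K" using convexD_alt[OF cvx p z(1), of t] t
        by (simp add: q_def algebra_simps)
      have "(dist q c)\<^sup>2 = (1 - t) * (dist p c)\<^sup>2 + t * (dist z c)\<^sup>2 - t * (1 - t) * D\<^sup>2"
        unfolding q_def D_def by (rule dist_sq_affine)
      moreover have "(dist p c)\<^sup>2 \<le> h\<^sup>2" "(dist z c)\<^sup>2 \<le> h\<^sup>2"
        using diam p z c by (auto intro!: power_mono)
      moreover from this have "(1 - t) * (dist p c)\<^sup>2 \<le> (1 - t) * h\<^sup>2" "t * (dist z c)\<^sup>2 \<le> t * h\<^sup>2"
        using t by (auto intro!: mult_left_mono)
      ultimately have 1: "(dist q c)\<^sup>2 \<le> h\<^sup>2 - t * (1 - t) * D\<^sup>2"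
        by (simp only: left_diff_distrib mult_1_left)
      have "u \<bullet> (q - c) \<le> h"
        using norm_cauchy_schwarz[of u "q - c"] u diam[OF q c] by (simp add: dist_norm)
      then have 2: "2 * (t * \<sigma>) * (u \<bullet> (q - c)) \<le> 2 * (t * \<sigma>) * h"
        using t s by (intro mult_left_mono) auto
      have "(dist w c)\<^sup>2 = (dist q c)\<^sup>2 + 2 * (t * \<sigma>) * (u \<bullet> (q - c)) + (t * \<sigma>)\<^sup>2"
      proof -
        have "w - c = (q - c) + (t * \<sigma>) *\<^sub>R u" by (simp add: w_def q_def)
        then have "(dist w c)\<^sup>2 = ((q - c) + (t * \<sigma>) *\<^sub>R u) \<bullet> ((q - c) + (t * \<sigma>) *\<^sub>R u)"
          by (simp only: dist_norm power2_norm_eq_inner)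
        also have "\<dots> = (q - c) \<bullet> (q - c) + 2 * (t * \<sigma>) * (u \<bullet> (q - c)) + (t * \<sigma>)\<^sup>2 * (u \<bullet> u)"
          by (simp only: inner_add_left inner_add_right inner_scaleR_left inner_scaleR_right
              inner_commute[of "q - c" u]) (simp add: power2_eq_square algebra_simps)
        finally show ?thesis
          using u by (simp add: dist_norm power2_norm_eq_inner norm_eq_1)
      qed
      also have "\<dots> \<le> h\<^sup>2 + t * (2 * h * \<sigma> + t * (D\<^sup>2 + \<sigma>\<^sup>2) - D\<^sup>2)"
        using 1 2 by (simp add: algebra_simps power2_eq_square)
      also have "\<dots> \<le> h\<^sup>2" using t by (simp add: mult_nonneg_nonpos)
      finally show ?thesis using h by (simp add: dist_commute abs_le_square_iff[symmetric])
    qed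
    then have "w \<in> K" using K(1) by (metis mem_bpoly)
    moreover have "u \<bullet> w = u \<bullet> p + t * (u \<bullet> (z - p) + \<sigma>)"
      using u by (simp add: w_def inner_add_right norm_eq_1 distrib_left)
    moreover have "t * (u \<bullet> (z - p) + \<sigma>) > 0" using t s by simp
    ultimately show False using max[of w] by simp
  qed
  have width: "(SUP p\<in>K. u \<bullet> p) - (INF p\<in>K. u \<bullet> p) = h" if u: "norm u = 1" for u
  proof -
    have cont: "continuous_on K (\<lambda>q. u \<bullet> q)" by (intro continuous_intros)
    obtain p where p: "p \<in> K" "\<And>q. q \<in> K \<Longrightarrow> u \<bullet> q \<le> u \<bullet> p"
      using continuous_attains_sup[OF cpt K(2) cont] by blast
    have q: "p - h *\<^sub>R u \<in> K" by (rule antipode[OF u p])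
    have uq: "u \<bullet> (p - h *\<^sub>R u) = u \<bullet> p - h" using u by (simp add: inner_diff_right norm_eq_1)
    have "u \<bullet> p - h \<le> u \<bullet> z" if "z \<in> K" for z
      using norm_cauchy_schwarz[of u "p - z"] u diam[OF p(1) that]
      by (simp add: dist_norm inner_diff_right)
    then have "(INF p\<in>K. u \<bullet> p) = u \<bullet> p - h"
      using q uq by (intro cInf_eq_minimum) (auto intro!: image_eqI[of _ _ "p - h *\<^sub>R u"])
    moreover have "(SUP p\<in>K. u \<bullet> p) = u \<bullet> p"
      using p by (intro cSup_eq_maximum) auto
    ultimately show ?thesis by simp
  qed
  \<comment> \<open>A convex set without interior lies in a plane and has width 0 in the normal
    direction.\<close>
  have "interior K \<noteq> {}"
  proof
    assume "interior K = {}"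
    then obtain v r where v: "v \<noteq> 0" "K \<subseteq> {q. v \<bullet> q = r}"
      using empty_interior_subset_hyperplane[OF cvx] by metis
    define u where "u = sgn v"
    have u: "norm u = 1" using v by (simp add: u_def norm_sgn)
    have "u \<bullet> q = r / norm v" if "q \<in> K" for q
      using v(2) that by (auto simp: u_def sgn_div_norm divide_inverse)
    then have "(\<lambda>q. u \<bullet> q) ` K = {r / norm v}" using K(2) by force
    then show False using width[OF u] h by simp
  qed
  then show ?thesis using cpt cvx width by (simp add: convex_body_def constant_width_def)
qed

section \<open>The orthogonal frame of a pair of dual edges\<close>

text \<open>\<open>m\<close> is the midpoint of \<open>x\<close> and \<open>y\<close>,
  \<open>m + k *\<^sub>R e3\<close> that of \<open>a\<close> and \<open>b\<close>; \<alpha> and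
  \<beta> are half of \<open>dist a b\<close> and \<open>dist x y\<close>. \<open>h_sq\<close> says
  that the four distances between the pairs are \<open>h\<close>, and \<open>k_large\<close> is what
  remains of \<open>dist a b \<le> h\<close> and \<open>dist x y \<le> h\<close>.\<close>

locale dual_frame =
  fixes a b x y m e1 e2 e3 :: pt and \<alpha> \<beta> k h :: real
  assumes orthonormal: "e1 \<bullet> e1 = 1" "e2 \<bullet> e2 = 1" "e3 \<bullet> e3 = 1"
      "e1 \<bullet> e2 = 0" "e1 \<bullet> e3 = 0" "e2 \<bullet> e3 = 0"
    and pos: "\<alpha> > 0" "\<beta> > 0" "k > 0" "h > 0"
    and h_sq: "\<alpha>\<^sup>2 + \<beta>\<^sup>2 + k\<^sup>2 = h\<^sup>2"
    and k_large: "h\<^sup>2 \<le> 2 * k\<^sup>2"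
    and a_eq: "a = m + \<alpha> *\<^sub>R e1 + k *\<^sub>R e3"
    and b_eq: "b = m - \<alpha> *\<^sub>R e1 + k *\<^sub>R e3"
    and x_eq: "x = m + \<beta> *\<^sub>R e2"
    and y_eq: "y = m - \<beta> *\<^sub>R e2"
begin

definition P :: "real \<Rightarrow> real \<Rightarrow> real \<Rightarrow> pt" where
  "P r s t = m + r *\<^sub>R e1 + s *\<^sub>R e2 + t *\<^sub>R e3"

lemma corners: "a = P \<alpha> 0 k" "b = P (- \<alpha>) 0 k" "x = P 0 \<beta> 0" "y = P 0 (- \<beta>) 0"
  by (simp_all add: P_def a_eq b_eq x_eq y_eq)

lemma P_diff: "P r s t - P r' s' t' = (r - r') *\<^sub>R e1 + (s - s') *\<^sub>R e2 + (t - t') *\<^sub>R e3"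
  by (simp add: P_def algebra_simps)

lemma inner_frame:
  "(r *\<^sub>R e1 + s *\<^sub>R e2 + t *\<^sub>R e3) \<bullet> (r' *\<^sub>R e1 + s' *\<^sub>R e2 + t' *\<^sub>R e3) = r * r' + s * s' + t * t'"
  using orthonormal by (simp add: inner_add_left inner_add_right inner_commute)

lemma frame_comb:
  "u *\<^sub>R (r *\<^sub>R e1 + s *\<^sub>R e2 + t *\<^sub>R e3) + v *\<^sub>R (r' *\<^sub>R e1 + s' *\<^sub>R e2 + t' *\<^sub>R e3) =
    (u * r + v * r') *\<^sub>R e1 + (u * s + v * s') *\<^sub>R e2 + (u * t + v * t') *\<^sub>R e3"
  by (simp add: algebra_simps)

lemma dist_P_sq: "(dist (P r s t) (P r' s' t'))\<^sup>2 = (r - r')\<^sup>2 + (s - s')\<^sup>2 + (t - t')\<^sup>2"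
  by (simp add: dist_norm power2_norm_eq_inner P_diff inner_frame) (simp add: power2_eq_square)

lemma dist_P_le: "dist (P r s t) (P r' s' t') \<le> h \<longleftrightarrow> (r - r')\<^sup>2 + (s - s')\<^sup>2 + (t - t')\<^sup>2 \<le> h\<^sup>2"
  using abs_le_square_iff[of "dist (P r s t) (P r' s' t')" h] pos by (simp add: dist_P_sq)

lemma dist_P_eq: "dist (P r s t) (P r' s' t') = h \<longleftrightarrow> (r - r')\<^sup>2 + (s - s')\<^sup>2 + (t - t')\<^sup>2 = h\<^sup>2"
  using power2_eq_iff_nonneg[of "dist (P r s t) (P r' s' t')" h] pos by (simp add: dist_P_sq)

lemma P_inject [simp]: "P r s t = P r' s' t' \<longleftrightarrow> r = r' \<and> s = s' \<and> t = t'"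
proof -
  have "P r s t = P r' s' t' \<longleftrightarrow> (dist (P r s t) (P r' s' t'))\<^sup>2 = 0" by simp
  also have "\<dots> \<longleftrightarrow> r = r' \<and> s = s' \<and> t = t'"
    unfolding dist_P_sq by (simp add: add_nonneg_eq_0_iff)
  finally show ?thesis .
qed

lemma P_cases: obtains r s t where "z = P r s t"
proof -
  define v where "v = z - m"
  have norms: "norm e1 = 1" "norm e2 = 1" "norm e3 = 1"
    using orthonormal by (simp_all add: norm_eq_1)
  have distinct: "e1 \<noteq> e2" "e1 \<noteq> e3" "e2 \<noteq> e3"
    using orthonormal by auto
  have "independent {e1, e2, e3}"
    using orthonormal by (intro pairwise_orthogonal_independent)
      (auto simp: pairwise_def orthogonal_def inner_commute)
  then have "v \<in> span {e1, e2, e3}"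
    using card_ge_dim_independent[of "{e1, e2, e3}" UNIV] distinct by (auto simp: dim_UNIV)
  then obtain r s t where "v = r *\<^sub>R e1 + s *\<^sub>R e2 + t *\<^sub>R e3"
    by (auto simp: span_breakdown_eq algebra_simps)
  then have "z = P r s t" by (simp add: P_def v_def algebra_simps)
  then show thesis by (rule that)
qed

text \<open>For the label \<open>{a,b}\<close> with endpoints \<open>x, y\<close>: \<open>edge\<close> is \<open>\<tau>(a) \<inter> \<tau>(b)\<close>, \<open>dual_edge\<close> is
  \<open>\<tau>(x) \<inter> \<tau>(y)\<close>, and \<open>meridian c\<close> is the arc of the wedge \<open>W(x,y)\<close> with centre \<open>c\<close>.\<close>
definition edge :: "pt set" where
  "edge = {P 0 s t | s t. s\<^sup>2 + (t - k)\<^sup>2 = \<beta>\<^sup>2 + k\<^sup>2 \<and> t \<le> 0}"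

definition dual_edge :: "pt set" where
  "dual_edge = {P r 0 t | r t. r\<^sup>2 + t\<^sup>2 = \<alpha>\<^sup>2 + k\<^sup>2 \<and> k \<le> t}"

definition meridian :: "pt \<Rightarrow> pt set" where
  "meridian c = {p. dist c p = h \<and> (\<exists>\<nu> s. \<nu> \<le> 0 \<and> p = m + \<nu> *\<^sub>R (c - m) + s *\<^sub>R e2)}"

lemma dist_corners_edge:
  "dist (P r s t) a = h \<and> dist (P r s t) b = h \<longleftrightarrow> r = 0 \<and> s\<^sup>2 + (t - k)\<^sup>2 = \<beta>\<^sup>2 + k\<^sup>2"
proof -
  have "(r + \<alpha>)\<^sup>2 = (r - \<alpha>)\<^sup>2 + 4 * r * \<alpha>" by (simp add: power2_eq_square algebra_simps)
  then have "dist (P r s t) a = h \<and> dist (P r s t) b = h \<longleftrightarrow>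
     (r - \<alpha>)\<^sup>2 + s\<^sup>2 + (t - k)\<^sup>2 = h\<^sup>2 \<and> 4 * r * \<alpha> = 0"
    unfolding corners dist_P_eq by (smt (verit))
  also have "\<dots> \<longleftrightarrow> r = 0 \<and> s\<^sup>2 + (t - k)\<^sup>2 = \<beta>\<^sup>2 + k\<^sup>2"
    using pos h_sq by auto
  finally show ?thesis .
qed

lemma dist_dual_edge:
  assumes "r\<^sup>2 + t\<^sup>2 = \<alpha>\<^sup>2 + k\<^sup>2"
  shows "dist (P r 0 t) x = h" "dist (P r 0 t) y = h"
  using assms h_sq unfolding corners dist_P_eq by auto

lemma corners_mem: "a \<in> dual_edge" "b \<in> dual_edge" "x \<in> edge" "y \<in> edge"
  unfolding corners edge_def dual_edge_def using pos by auto

lemma meridian_P: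
  "P r s t \<in> meridian (P r' 0 t') \<longleftrightarrow>
     (r - r')\<^sup>2 + s\<^sup>2 + (t - t')\<^sup>2 = h\<^sup>2 \<and> (\<exists>\<nu>\<le>0. r = \<nu> * r' \<and> t = \<nu> * t')"
proof -
  have "m + \<nu> *\<^sub>R (P r' 0 t' - m) + s' *\<^sub>R e2 = P (\<nu> * r') s' (\<nu> * t')" for \<nu> s'
    by (simp add: P_def algebra_simps)
  then show ?thesis
    using dist_P_eq[of r' 0 t' r s t] unfolding meridian_def
    by (auto simp: power2_commute)
qed

lemma minor_arc_commute: "minor_arc c r x y = minor_arc c r y x"
proof -
  have "minor_arc c r x y \<subseteq> minor_arc c r y x" for x y
    unfolding minor_arc_def
    by (clarsimp, rule_tac x="1 - t" in exI) (simp add: add.commute)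
  then show ?thesis by blast
qed

text \<open>The \<open>e2\<close>-extent of a meridian beyond the axis is at most that of its chord \<open>x y\<close>.\<close>
lemma meridian_in_cone:
  assumes "p \<in> meridian (P r 0 t)" "r\<^sup>2 + t\<^sup>2 = \<alpha>\<^sup>2 + k\<^sup>2"
  obtains \<kappa> \<mu> where "\<kappa> \<ge> 0" "\<mu> \<ge> 0" "\<kappa> + \<mu> \<ge> 1"
    "p - P r 0 t = \<kappa> *\<^sub>R (x - P r 0 t) + \<mu> *\<^sub>R (y - P r 0 t)"
proof -
  obtain p1 p2 p3 where p: "p = P p1 p2 p3" by (rule P_cases)
  with assms obtain \<nu> where nu: "\<nu> \<le> 0" "p1 = \<nu> * r" "p3 = \<nu> * t"
    and d: "(p1 - r)\<^sup>2 + p2\<^sup>2 + (p3 - t)\<^sup>2 = h\<^sup>2" by (auto simp: meridian_P)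
  have "(p1 - r)\<^sup>2 + (p3 - t)\<^sup>2 = (1 - \<nu>)\<^sup>2 * (\<alpha>\<^sup>2 + k\<^sup>2)"
    unfolding assms(2)[symmetric] nu by (simp add: power2_eq_square algebra_simps)
  moreover have "(1 - \<nu>)\<^sup>2 \<ge> 1" using nu by (simp add: one_le_power)
  ultimately have "p2\<^sup>2 \<le> \<beta>\<^sup>2"
    using d h_sq mult_right_mono[of 1 "(1 - \<nu>)\<^sup>2" "\<alpha>\<^sup>2 + k\<^sup>2"] by simp
  then have "\<bar>p2\<bar> \<le> \<beta>" using abs_le_square_iff[of p2 \<beta>] pos by simp
  moreover have "\<beta> \<le> \<beta> * (1 - \<nu>)" using pos nu by (simp add: algebra_simps mult_nonneg_nonpos)
  ultimately have bnd: "\<bar>p2\<bar> \<le> \<beta> * (1 - \<nu>)" by simp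
  define \<kappa> \<mu> where "\<kappa> = (1 - \<nu> + p2 / \<beta>) / 2" and "\<mu> = (1 - \<nu> - p2 / \<beta>) / 2"
  have "\<bar>p2 / \<beta>\<bar> \<le> 1 - \<nu>" using bnd pos by (simp add: field_simps)
  then have "\<kappa> \<ge> 0" "\<mu> \<ge> 0" by (simp_all add: \<kappa>_def \<mu>_def abs_le_iff del: abs_divide)
  moreover have sum: "\<kappa> + \<mu> = 1 - \<nu>" and diff: "(\<kappa> - \<mu>) * \<beta> = p2"
    using pos by (auto simp: \<kappa>_def \<mu>_def field_simps)
  moreover have "p - P r 0 t = \<kappa> *\<^sub>R (x - P r 0 t) + \<mu> *\<^sub>R (y - P r 0 t)"
  proof -
    have "\<kappa> *\<^sub>R (x - P r 0 t) + \<mu> *\<^sub>R (y - P r 0 t)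
        = (- (\<kappa> + \<mu>) * r) *\<^sub>R e1 + ((\<kappa> - \<mu>) * \<beta>) *\<^sub>R e2 + (- (\<kappa> + \<mu>) * t) *\<^sub>R e3"
      by (simp add: corners P_diff algebra_simps)
    also have "\<dots> = p - P r 0 t"
      unfolding p P_diff sum diff nu by (simp add: algebra_simps)
    finally show ?thesis by simp
  qed
  ultimately show thesis using nu by (intro that[of \<kappa> \<mu>]) auto
qed

text \<open>First-order conditions yield the description by \<nu>, while wedges are made of minor
  arcs. Normalizing the cone coefficients to sum 1 gives the arc parameter; conversely, a point of
  the chord is within \<open>h\<close> of \<open>c\<close>, so pushing it out to the sphere moves it
  past the axis and makes \<nu> nonpositive.\<close>

lemma meridian_eq_minor_arc:
  assumes c: "c \<in> dual_edge"
  shows "meridian c = minor_arc c h x y"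
proof (intro equalityI subsetI)
  obtain r t where rt: "c = P r 0 t" "r\<^sup>2 + t\<^sup>2 = \<alpha>\<^sup>2 + k\<^sup>2" using c by (auto simp: dual_edge_def)
  {
    fix p assume p: "p \<in> meridian c"
    then have d: "norm (p - c) = h" by (simp add: meridian_def dist_norm norm_minus_commute)
    from meridian_in_cone p rt obtain \<kappa> \<mu> where lm: "\<kappa> \<ge> 0" "\<mu> \<ge> 0" "\<kappa> + \<mu> \<ge> 1"
      "p - c = \<kappa> *\<^sub>R (x - c) + \<mu> *\<^sub>R (y - c)" by metis
    define \<tau> where "\<tau> = \<mu> / (\<kappa> + \<mu>)"
    have "(1 - \<tau>) *\<^sub>R (x - c) + \<tau> *\<^sub>R (y - c) = (1 / (\<kappa> + \<mu>)) *\<^sub>R (p - c)"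
      unfolding lm(4) \<tau>_def using lm(3)
      by (simp add: scaleR_add_right divide_simps)
    then have "sgn ((1 - \<tau>) *\<^sub>R (x - c) + \<tau> *\<^sub>R (y - c)) = sgn (p - c)"
      using lm(3) by (simp add: sgn_scaleR)
    then have "p = c + h *\<^sub>R sgn ((1 - \<tau>) *\<^sub>R (x - c) + \<tau> *\<^sub>R (y - c))"
      using d pos by (simp add: sgn_div_norm)
    moreover have "\<tau> \<in> {0..1}" using lm by (auto simp: \<tau>_def)
    ultimately show "p \<in> minor_arc c h x y" unfolding minor_arc_def by blast
  }
  {
    fix p assume "p \<in> minor_arc c h x y"
    then obtain \<tau> where tau: "\<tau> \<in> {0..1}" "p = c + h *\<^sub>R sgn ((1 - \<tau>) *\<^sub>R (x - c) + \<tau> *\<^sub>R (y - c))"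
      by (auto simp: minor_arc_def)
    define w where "w = (1 - \<tau>) *\<^sub>R (x - c) + \<tau> *\<^sub>R (y - c)"
    have w: "w = (- r) *\<^sub>R e1 + ((1 - 2 * \<tau>) * \<beta>) *\<^sub>R e2 + (- t) *\<^sub>R e3"
      unfolding w_def rt corners P_diff frame_comb by (simp add: algebra_simps)
    have dx: "norm (x - c) = h" "norm (y - c) = h"
      using dist_dual_edge[OF rt(2)] by (simp_all add: rt dist_norm norm_minus_commute)
    have "norm w \<le> (1 - \<tau>) * norm (x - c) + \<tau> * norm (y - c)"
      unfolding w_def using tau by (intro order.trans[OF norm_triangle_ineq]) simp
    then have le: "norm w \<le> h" by (simp add: dx algebra_simps)
    have "(norm w)\<^sup>2 = r\<^sup>2 + ((1 - 2 * \<tau>) * \<beta>)\<^sup>2 + t\<^sup>2"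
      unfolding power2_norm_eq_inner w inner_frame by (simp add: power2_eq_square)
    then have "(norm w)\<^sup>2 > 0" using rt(2) pos by (smt (verit) zero_less_power zero_le_power2)
    then have pw: "norm w > 0" by simp
    define s where "s = h / norm w"
    have s: "s \<ge> 1" using le pw by (simp add: s_def)
    have pe: "p = c + s *\<^sub>R w" using tau(2) by (simp add: w_def[symmetric] s_def sgn_div_norm divide_inverse)
    then have "dist c p = h" using pw pos by (simp add: dist_norm s_def)
    moreover have "p = m + (1 - s) *\<^sub>R (c - m) + (s * (1 - 2 * \<tau>) * \<beta>) *\<^sub>R e2"
      unfolding pe w rt(1) P_def by (simp add: algebra_simps)
    ultimately show "p \<in> meridian c" unfolding meridian_def using s
      by (intro CollectI conjI exI[of _ "1 - s"] exI[of _ "s * (1 - 2 * \<tau>) * \<beta>"]) auto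
  }
qed


text \<open>Two symmetries carry one-sided results over: exchanging \<open>a\<close> and
  \<open>b\<close> reflects \<open>e1\<close>; exchanging the two dual edges moves the origin to the
  midpoint of \<open>a\<close> and \<open>b\<close> and reverses \<open>e3\<close>.\<close>

lemma swap_frame: "dual_frame b a x y m (- e1) e2 e3 \<alpha> \<beta> k h"
  using orthonormal pos h_sq k_large by unfold_locales (simp_all add: a_eq b_eq x_eq y_eq)

lemma dual_frame: "dual_frame x y a b (m + k *\<^sub>R e3) e2 e1 (- e3) \<beta> \<alpha> k h"
  using orthonormal pos h_sq k_large
  by unfold_locales (simp_all add: a_eq b_eq x_eq y_eq inner_commute)

lemma swap_P: "dual_frame.P m (- e1) e2 e3 r s t = P (- r) s t"
  using dual_frame.P_def[OF swap_frame] by (simp add: P_def)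

lemma dual_P: "dual_frame.P (m + k *\<^sub>R e3) e2 e1 (- e3) r s t = P s r (k - t)"
  using dual_frame.P_def[OF dual_frame] by (simp add: P_def algebra_simps)

lemma swap_dual_edge: "dual_frame.dual_edge m (- e1) e2 e3 \<alpha> k = dual_edge"
proof -
  have "P r 0 t \<in> {P (- r) 0 t | r t. r\<^sup>2 + t\<^sup>2 = \<alpha>\<^sup>2 + k\<^sup>2 \<and> k \<le> t}
      \<longleftrightarrow> r\<^sup>2 + t\<^sup>2 = \<alpha>\<^sup>2 + k\<^sup>2 \<and> k \<le> t" for r t
    by (auto intro!: exI[of _ "- r"])
  then show ?thesis
    unfolding dual_frame.dual_edge_def[OF swap_frame] dual_edge_def swap_P by fastforce
qed

lemma swap_edge: "dual_frame.edge m (- e1) e2 e3 \<beta> k = edge"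
  unfolding dual_frame.edge_def[OF swap_frame] edge_def swap_P by simp

lemma dual_edge_of_dual: "dual_frame.edge (m + k *\<^sub>R e3) e2 e1 (- e3) \<alpha> k = dual_edge"
proof -
  have "\<exists>s t'. P r 0 t = P s 0 (k - t') \<and> s\<^sup>2 + (t' - k)\<^sup>2 = \<alpha>\<^sup>2 + k\<^sup>2 \<and> t' \<le> 0"
    if "r\<^sup>2 + t\<^sup>2 = \<alpha>\<^sup>2 + k\<^sup>2" "k \<le> t" for r t
    using that by (intro exI[of _ r] exI[of _ "k - t"]) auto
  moreover have "\<exists>r t'. P s 0 (k - t) = P r 0 t' \<and> r\<^sup>2 + t'\<^sup>2 = \<alpha>\<^sup>2 + k\<^sup>2 \<and> k \<le> t'"
    if "s\<^sup>2 + (t - k)\<^sup>2 = \<alpha>\<^sup>2 + k\<^sup>2" "t \<le> 0" for s t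
    using that by (intro exI[of _ s] exI[of _ "k - t"]) (auto simp: power2_commute)
  ultimately show ?thesis
    unfolding dual_frame.edge_def[OF dual_frame] dual_edge_def dual_P by auto
qed

text \<open>A linear form vanishing on the plane through \<open>x\<close>, \<open>y\<close> and
  \<open>a\<close>. On the face of \<open>a\<close>, its negative side is the lune that surgery
  removes.\<close>

definition side :: "pt \<Rightarrow> real" where
  "side p = (\<alpha> *\<^sub>R e3 - k *\<^sub>R e1) \<bullet> (p - m)"

lemma side_P [simp]: "side (P r s t) = \<alpha> * t - k * r"
proof -
  have "\<alpha> *\<^sub>R e3 - k *\<^sub>R e1 = (- k) *\<^sub>R e1 + 0 *\<^sub>R e2 + \<alpha> *\<^sub>R e3" by simp
  moreover have "P r s t - m = r *\<^sub>R e1 + s *\<^sub>R e2 + t *\<^sub>R e3" by (simp add: P_def)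
  ultimately show ?thesis unfolding side_def by (simp only: inner_frame)
qed

lemma swap_side_P: "dual_frame.side m (- e1) e3 \<alpha> k (P r s t) = \<alpha> * t + k * r"
  using dual_frame.side_P[OF swap_frame, of "- r" s t] by (simp add: swap_P)

section \<open>Balls centred on the dual edge, seen from a face\<close>

lemma dist_b_P:
  assumes "dist (P r s t) a = h"
  shows "dist (P r s t) b \<le> h \<longleftrightarrow> r \<le> 0" "dist (P r s t) b = h \<longleftrightarrow> r = 0"
proof -
  have "(r + \<alpha>)\<^sup>2 + s\<^sup>2 + (t - k)\<^sup>2 = h\<^sup>2 + 4 * \<alpha> * r"
    using assms unfolding corners dist_P_eq by (simp add: power2_eq_square algebra_simps)
  then show "dist (P r s t) b \<le> h \<longleftrightarrow> r \<le> 0" "dist (P r s t) b = h \<longleftrightarrow> r = 0"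
    unfolding corners dist_P_le dist_P_eq using pos by (auto simp: mult_le_0_iff)
qed

lemma edge_iff: "P r s t \<in> edge \<longleftrightarrow> dist (P r s t) a = h \<and> dist (P r s t) b = h \<and> t \<le> 0"
  unfolding dist_corners_edge conj_assoc[symmetric] by (auto simp: edge_def)

text \<open>Both centres lie on one circle about \<open>m\<close>, so the quadratic terms
  cancel.\<close>

lemma dist_dual_edge_le:
  assumes c: "r'\<^sup>2 + t'\<^sup>2 = \<alpha>\<^sup>2 + k\<^sup>2" and p: "dist (P r s t) c' = h"
    and c': "c' = P r0 0 t0" "r0\<^sup>2 + t0\<^sup>2 = \<alpha>\<^sup>2 + k\<^sup>2"
  shows "dist (P r s t) (P r' 0 t') \<le> h \<longleftrightarrow> 0 \<le> (r' - r0) * r + (t' - t0) * t"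
proof -
  define D where "D = (r' - r0) * r + (t' - t0) * t"
  have "(r - r')\<^sup>2 + s\<^sup>2 + (t - t')\<^sup>2 = h\<^sup>2 - 2 * D" unfolding D_def
    using p c c'(2) unfolding c'(1) dist_P_eq by (simp add: power2_eq_square algebra_simps)
  then show ?thesis by (auto simp: dist_P_le D_def[symmetric])
qed

text \<open>Nothing on the nonnegative side of the plane is cut off. After \<open>t\<close> is
  eliminated by means of \<open>side p\<close>, \<alpha> times the linear criterion is at least
  \<open>- r\<close> times half the squared distance from \<open>c\<close> to \<open>a\<close>, and
  \<open>r \<le> 0\<close>.\<close>

lemma dual_edge_dist_le:
  assumes p: "dist p a = h" "dist p b \<le> h" "0 \<le> side p" and c: "c \<in> dual_edge"
  shows "dist p c \<le> h"
proof -
  obtain r s t where P: "p = P r s t" by (rule P_cases)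
  obtain r' t' where c: "c = P r' 0 t'" "r'\<^sup>2 + t'\<^sup>2 = \<alpha>\<^sup>2 + k\<^sup>2" "k \<le> t'"
    using c by (auto simp: dual_edge_def)
  have r: "r \<le> 0" using p(1,2) dist_b_P unfolding P by blast
  have st: "k * r \<le> \<alpha> * t" using p(3) by (simp add: P)
  have "r'\<^sup>2 \<le> \<alpha>\<^sup>2" using c pos by (smt (verit) power_mono)
  then have r': "\<bar>r'\<bar> \<le> \<alpha>" using abs_le_square_iff[of r' \<alpha>] pos by simp
  have "0 \<le> \<alpha> * ((r' - \<alpha>) * r + (t' - k) * t)"
  proof -
    have "\<alpha> * ((r' - \<alpha>) * r + (t' - k) * t) = \<alpha> * ((r' - \<alpha>) * r) + (t' - k) * (\<alpha> * t)"
      by (simp add: algebra_simps)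
    also have "\<dots> \<ge> \<alpha> * ((r' - \<alpha>) * r) + (t' - k) * (k * r)"
      using c st by (intro add_left_mono mult_left_mono) auto
    also have "\<alpha> * ((r' - \<alpha>) * r) + (t' - k) * (k * r) = - r * (\<alpha>\<^sup>2 + k\<^sup>2 - (\<alpha> * r' + k * t'))"
      by (simp add: power2_eq_square algebra_simps)
    also have "\<alpha>\<^sup>2 + k\<^sup>2 - (\<alpha> * r' + k * t') = ((r' - \<alpha>)\<^sup>2 + (t' - k)\<^sup>2) / 2"
      using c(2) by (simp add: power2_eq_square algebra_simps)
    finally show ?thesis using r by (smt (verit) mult_nonneg_nonneg zero_le_power2 divide_nonneg_pos)
  qed
  then have "0 \<le> (r' - \<alpha>) * r + (t' - k) * t" using pos by (simp add: zero_le_mult_iff)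
  then show ?thesis
    using dist_dual_edge_le[OF c(2), of r s t a \<alpha> k] p(1) unfolding P c(1) by (simp add: corners)
qed

text \<open>First-order condition obtained by rotating the centre \<open>c\<close> along the dual edge towards \<open>b\<close>;
  the rotation angle is \<open>2 arctan \<tau>\<close>.\<close>
lemma rotate_towards_b:
  assumes le: "\<And>c. c \<in> dual_edge \<Longrightarrow> dist (P r s t) c \<le> h"
    and c: "r'\<^sup>2 + t'\<^sup>2 = \<alpha>\<^sup>2 + k\<^sup>2" "k \<le> t'" "k < t' \<or> 0 < r'"
    and eq: "dist (P r s t) (P r' 0 t') = h"
  shows "t' * r \<le> r' * t"
proof -
  have "\<forall>\<^sub>F \<tau> in at_right 0. k * (1 + \<tau>\<^sup>2) \<le> t' * (1 - \<tau>\<^sup>2) + 2 * \<tau> * r'"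
  proof (cases "k < t'")
    case True
    have "((\<lambda>\<tau>. t' * (1 - \<tau>\<^sup>2) + 2 * \<tau> * r' - k * (1 + \<tau>\<^sup>2)) \<longlongrightarrow> t' * (1 - 0\<^sup>2) + 2 * 0 * r' - k * (1 + 0\<^sup>2)) (at_right 0)"
      by (intro tendsto_intros)
    then have "\<forall>\<^sub>F \<tau> in at_right 0. 0 < t' * (1 - \<tau>\<^sup>2) + 2 * \<tau> * r' - k * (1 + \<tau>\<^sup>2)"
      using True by (intro order_tendstoD(1)) auto
    then show ?thesis by eventually_elim simp
  next
    case False
    then have t': "t' = k" "0 < r'" using c by auto
    have "\<forall>\<^sub>F \<tau> in at_right 0. \<tau> \<in> {0<..<r' / k}"
      using t' pos by (intro eventually_at_right_real) simp
    then show ?thesis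
    proof eventually_elim
      case (elim \<tau>)
      then have "\<tau> * (k * \<tau>) \<le> \<tau> * r'" using pos by (intro mult_left_mono) (auto simp: field_simps)
      then show ?case by (simp add: t' power2_eq_square algebra_simps)
    qed
  qed
  then have "\<forall>\<^sub>F \<tau> in at_right 0. \<tau> * (r' * r + t' * t) \<le> r' * t - t' * r"
    using eventually_at_right_less[of 0]
  proof eventually_elim
    case (elim \<tau>)
    define q where "q = 1 + \<tau>\<^sup>2"
    have q: "q > 0" by (simp add: q_def add_pos_nonneg)
    define r'' t'' where "r'' = (r' * (1 - \<tau>\<^sup>2) - 2 * \<tau> * t') / q" and "t'' = (t' * (1 - \<tau>\<^sup>2) + 2 * \<tau> * r') / q"
    have rt: "r'' * q = r' * (1 - \<tau>\<^sup>2) - 2 * \<tau> * t'" "t'' * q = t' * (1 - \<tau>\<^sup>2) + 2 * \<tau> * r'"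
      using q by (simp_all add: r''_def t''_def)
    have "(r''\<^sup>2 + t''\<^sup>2) * q\<^sup>2 = (r'' * q)\<^sup>2 + (t'' * q)\<^sup>2" by (simp add: algebra_simps power_mult_distrib)
    also have "\<dots> = (r'\<^sup>2 + t'\<^sup>2) * q\<^sup>2"
      unfolding rt by (simp add: q_def power2_eq_square algebra_simps)
    finally have sq: "r''\<^sup>2 + t''\<^sup>2 = \<alpha>\<^sup>2 + k\<^sup>2" using q c by simp
    have "k * q \<le> t'' * q" unfolding rt(2) using elim(1) by (simp add: q_def)
    then have "k \<le> t''" using q by simp
    then have "P r'' 0 t'' \<in> dual_edge" using sq by (auto simp: dual_edge_def)
    then have "0 \<le> (r'' - r') * r + (t'' - t') * t"
      using le dist_dual_edge_le[OF sq eq refl c(1)] by simp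
    then have "0 \<le> q * ((r'' - r') * r + (t'' - t') * t)" using q by simp
    also have "\<dots> = (r'' * q - r' * q) * r + (t'' * q - t' * q) * t" by (simp add: algebra_simps)
    also have "\<dots> = 2 * \<tau> * (r' * t - t' * r - \<tau> * (r' * r + t' * t))"
      unfolding rt by (simp add: q_def power2_eq_square algebra_simps)
    finally show ?case using elim(2) by (simp add: zero_le_mult_iff)
  qed
  moreover have "((\<lambda>\<tau>. \<tau> * (r' * r + t' * t)) \<longlongrightarrow> 0 * (r' * r + t' * t)) (at_right 0)"
    by (intro tendsto_intros)
  ultimately have "0 * (r' * r + t' * t) \<le> r' * t - t' * r"
    by (intro tendsto_upperbound) auto
  then show ?thesis by simp
qed

text \<open>The first-order condition at the end \<open>a\<close> of the dual edge. Together with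
  \<open>dual_edge_dist_le\<close>: from the points of the sphere about \<open>a\<close> within
  \<open>h\<close> of \<open>b\<close>, the balls centred on the dual edge cut off exactly the open
  lune.\<close>

lemma side_nonneg:
  assumes "\<And>c. c \<in> dual_edge \<Longrightarrow> dist p c \<le> h" "dist p a = h"
  shows "0 \<le> side p"
proof -
  obtain r s t where P: "p = P r s t" by (rule P_cases)
  show ?thesis
    using rotate_towards_b[of r s t \<alpha> k] assms pos unfolding P corners by simp
qed

text \<open>The plane \<open>side p = 0\<close> cuts the sphere about \<open>a\<close> in a great
  circle through \<open>x\<close> and \<open>y\<close>; the ball about \<open>b\<close> selects its
  part beyond the axis.\<close>

lemma meridian_iff_side:
  assumes "dist p a = h"
  shows "p \<in> meridian a \<longleftrightarrow> dist p b \<le> h \<and> side p = 0"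
proof -
  obtain r s t where P: "p = P r s t" by (rule P_cases)
  have "(\<exists>\<nu>\<le>0. r = \<nu> * \<alpha> \<and> t = \<nu> * k) \<longleftrightarrow> r \<le> 0 \<and> \<alpha> * t - k * r = 0"
    using pos by (auto simp: mult_le_0_iff intro!: exI[of _ "r / \<alpha>"] simp: field_simps)
  then show ?thesis
    using assms dist_b_P(1)[of r s t] meridian_P[of r s t \<alpha> k]
    unfolding P by (auto simp: corners dist_P_eq)
qed

text \<open>An inner centre can be rotated both ways, and the two first-order conditions make the
  components of \<open>p - m\<close> and \<open>c - m\<close> orthogonal to \<open>e2\<close>
  parallel. Comparison with the ball about \<open>a\<close> fixes the sign of the factor.\<close>

lemma interior_centre_meridian:
  assumes le: "\<And>c. c \<in> dual_edge \<Longrightarrow> dist p c \<le> h"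
    and c: "c \<in> dual_edge" "c \<noteq> a" "c \<noteq> b" and eq: "dist p c = h"
  shows "p \<in> meridian c"
proof -
  obtain r s t where P: "p = P r s t" by (rule P_cases)
  obtain r' t' where c': "c = P r' 0 t'" "r'\<^sup>2 + t'\<^sup>2 = \<alpha>\<^sup>2 + k\<^sup>2" "k \<le> t'"
    using c by (auto simp: dual_edge_def)
  have "k \<noteq> t'"
    using c(2,3) c' by (auto simp: corners power2_eq_iff)
  then have t': "k < t'" using c' by simp
  have 1: "t' * r \<le> r' * t"
    using rotate_towards_b[of r s t r' t'] le c' t' eq unfolding P by auto
  have 2: "t' * (- r) \<le> - r' * t"
    using dual_frame.rotate_towards_b[OF swap_frame, of "- r" s t "- r'" t'] le c' t' eq
    unfolding swap_P swap_dual_edge P by auto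
  define \<nu> where "\<nu> = t / t'"
  have nu: "t = \<nu> * t'" "r = \<nu> * r'" using t' pos 1 2 by (auto simp: \<nu>_def field_simps)
  have "0 \<le> (\<alpha> - r') * r + (k - t') * t"
    using dist_dual_edge_le[OF _ eq[unfolded P] c'(1,2), of \<alpha> k] le[OF corners_mem(1)]
    by (simp add: P corners)
  also have "\<dots> = \<nu> * (\<alpha> * r' + k * t' - (r'\<^sup>2 + t'\<^sup>2))"
    unfolding nu by (simp add: power2_eq_square algebra_simps)
  also have "\<alpha> * r' + k * t' - (r'\<^sup>2 + t'\<^sup>2) = - ((\<alpha> - r')\<^sup>2 + (k - t')\<^sup>2) / 2"
    using c'(2) by (simp add: power2_eq_square algebra_simps)
  finally have "0 \<le> \<nu> * (- ((\<alpha> - r')\<^sup>2 + (k - t')\<^sup>2) / 2)" .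
  then have "\<nu> \<le> 0"
  proof -
    have "0 < (\<alpha> - r')\<^sup>2 + (k - t')\<^sup>2" using t' by (intro add_nonneg_pos) auto
    then have "- ((\<alpha> - r')\<^sup>2 + (k - t')\<^sup>2) / 2 < 0" by simp
    then show ?thesis using \<open>0 \<le> \<nu> * _\<close> by (metis mult_pos_neg not_le)
  qed
  then show ?thesis
    using nu eq unfolding P c'(1) meridian_P dist_P_eq by auto
qed

text \<open>Central projection from \<open>a\<close> to the plane of \<open>edge\<close>. It
  flattens the lune to the circular segment between \<open>edge\<close> and its chord
  \<open>x y\<close>: the \<open>e3\<close>-coordinate of the image has the sign of
  \<open>side\<close>.\<close>

lemma lune_projection:
  assumes p: "dist (P r s t) a = h" "r \<le> 0"
  obtains \<mu> where "0 < \<mu>" "\<mu> \<le> 1" "\<mu> * (\<alpha> - r) = \<alpha>"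
    "P 0 (\<mu> * s) (k + \<mu> * (t - k)) - a = \<mu> *\<^sub>R (P r s t - a)"
    "(k + \<mu> * (t - k)) * (\<alpha> - r) = side (P r s t)"
proof -
  define \<mu> where "\<mu> = \<alpha> / (\<alpha> - r)"
  have mu: "0 < \<mu>" "\<mu> \<le> 1" "\<mu> * (\<alpha> - r) = \<alpha>"
    using p(2) pos by (auto simp: \<mu>_def)
  have "0 - \<alpha> = \<mu> * (r - \<alpha>)" using mu(3) by (simp add: algebra_simps)
  then have "P 0 (\<mu> * s) (k + \<mu> * (t - k)) - a = \<mu> *\<^sub>R (P r s t - a)"
    unfolding corners P_diff by (simp add: scaleR_add_right)
  moreover have "(k + \<mu> * (t - k)) * (\<alpha> - r) = k * (\<alpha> - r) + (\<mu> * (\<alpha> - r)) * (t - k)"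
    by (simp add: algebra_simps)
  then have "(k + \<mu> * (t - k)) * (\<alpha> - r) = side (P r s t)"
    unfolding mu(3) by (simp add: algebra_simps)
  ultimately show thesis using mu that by blast
qed

text \<open>For \<open>f\<close> on the sphere about \<open>a\<close>,
  \<open>dist z f \<le> h\<close> is a linear condition on \<open>f - a\<close>. The projection of
  \<open>p\<close> lies between two edge points of equal height and inherits it; scaling back by
  \<open>1 / \<mu> \<ge> 1\<close> only helps, strictly unless \<open>z = a\<close> or
  \<open>p\<close> is also on the sphere about \<open>b\<close>.\<close>

lemma lune_dist:
  assumes p: "dist p a = h" "dist p b \<le> h" "side p \<le> 0"
    and z: "edge \<subseteq> cball z h"
  shows "dist z p \<le> h" "dist z p = h \<Longrightarrow> z = a \<or> dist p b = h"
proof -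
  obtain r s t where P: "p = P r s t" by (rule P_cases)
  have r: "r \<le> 0" using p(1,2) dist_b_P unfolding P by blast
  have ar: "\<alpha> - r > 0" using r pos by simp
  obtain \<mu> where mu: "0 < \<mu>" "\<mu> \<le> 1" "\<mu> * (\<alpha> - r) = \<alpha>"
    "P 0 (\<mu> * s) (k + \<mu> * (t - k)) - a = \<mu> *\<^sub>R (p - a)"
    "(k + \<mu> * (t - k)) * (\<alpha> - r) = side p"
    using lune_projection[OF p(1)[unfolded P] r] unfolding P by blast
  define s' t' where "s' = \<mu> * s" and "t' = k + \<mu> * (t - k)"
  have w: "P 0 s' t' - a = \<mu> *\<^sub>R (p - a)" using mu(4) by (simp add: s'_def t'_def)
  have "t' * (\<alpha> - r) \<le> 0" using mu(5) p(3) by (simp add: t'_def)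
  then have t': "t' \<le> 0" using ar by (simp add: mult_le_0_iff)
  have "dist (P 0 s' t') a = \<mu> * h"
    using w mu p(1) by (simp add: dist_norm)
  also have "\<dots> \<le> h" using mu pos by simp
  finally have "\<alpha>\<^sup>2 + s'\<^sup>2 + (t' - k)\<^sup>2 \<le> h\<^sup>2"
    unfolding corners dist_P_le by simp
  then have s': "s'\<^sup>2 \<le> \<beta>\<^sup>2 + k\<^sup>2 - (t' - k)\<^sup>2" using h_sq by simp
  \<comment> \<open>Half the length of the chord parallel to \<open>x y\<close> at height
    \<open>t'\<close>; its ends are the two edge points between which the projection lies.\<close>
  define \<sigma> where "\<sigma> = sqrt (\<beta>\<^sup>2 + k\<^sup>2 - (t' - k)\<^sup>2)"
  have "0 \<le> \<beta>\<^sup>2 + k\<^sup>2 - (t' - k)\<^sup>2" using s' by (smt (verit) zero_le_power2)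
  then have sig: "\<sigma>\<^sup>2 = \<beta>\<^sup>2 + k\<^sup>2 - (t' - k)\<^sup>2" "\<sigma> \<ge> 0" by (auto simp: \<sigma>_def)
  have "\<bar>s'\<bar> \<le> \<sigma>" using s' sig abs_le_square_iff[of s' \<sigma>] by simp
  have key: "(dist z a)\<^sup>2 \<le> 2 * ((z - a) \<bullet> (f - a))" if fe: "f \<in> edge" for f
  proof -
    obtain u v where f: "f = P 0 u v" "u\<^sup>2 + (v - k)\<^sup>2 = \<beta>\<^sup>2 + k\<^sup>2" "v \<le> 0"
      using fe by (auto simp: edge_def)
    then have "dist f a = h" using dist_corners_edge by blast
    moreover have "dist z f \<le> h" using z fe by auto
    then have "(dist z f)\<^sup>2 \<le> h\<^sup>2" by (intro power_mono) auto
    ultimately show ?thesis using dist_sq_expand[of z f a] by (simp add: dist_commute)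
  qed
  have mem: "P 0 \<sigma> t' \<in> edge" "P 0 (- \<sigma>) t' \<in> edge"
    using sig t' by (auto simp: edge_def)
  have shift: "P 0 u t' - a = (P 0 0 t' - a) + u *\<^sub>R e2" for u
    by (simp add: P_def)
  have "(dist z a)\<^sup>2 \<le> 2 * ((z - a) \<bullet> (P 0 0 t' - a)) - 2 * \<sigma> * \<bar>(z - a) \<bullet> e2\<bar>"
    using key[OF mem(1)] key[OF mem(2)] sig(2) unfolding shift[of \<sigma>] shift[of "- \<sigma>"]
    by (simp add: inner_add_right abs_if algebra_simps)
  also have "\<dots> \<le> 2 * ((z - a) \<bullet> (P 0 0 t' - a)) - 2 * \<bar>s'\<bar> * \<bar>(z - a) \<bullet> e2\<bar>"
    using \<open>\<bar>s'\<bar> \<le> \<sigma>\<close> by (intro diff_left_mono mult_right_mono) auto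
  also have "\<dots> \<le> 2 * ((z - a) \<bullet> (P 0 0 t' - a)) + 2 * s' * ((z - a) \<bullet> e2)"
    using abs_ge_minus_self[of "s' * ((z - a) \<bullet> e2)"] by (simp add: abs_mult)
  also have "\<dots> = 2 * ((z - a) \<bullet> (P 0 s' t' - a))"
    unfolding shift[of s'] by (simp add: inner_add_right algebra_simps)
  also have "\<dots> = \<mu> * (2 * ((z - a) \<bullet> (p - a)))" by (simp add: w)
  finally have "(dist z a)\<^sup>2 \<le> \<mu> * (2 * ((z - a) \<bullet> (p - a)))" .
  then have "(\<alpha> - r) * (dist z a)\<^sup>2 \<le> (\<alpha> - r) * (\<mu> * (2 * ((z - a) \<bullet> (p - a))))"
    using ar by (intro mult_left_mono) auto
  also have "\<dots> = (\<mu> * (\<alpha> - r)) * (2 * ((z - a) \<bullet> (p - a)))" by (simp only: mult_ac)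
  also have "\<dots> = \<alpha> * (2 * ((z - a) \<bullet> (p - a)))" unfolding mu(3) ..
  finally have "(\<alpha> - r) * (dist z a)\<^sup>2 \<le> \<alpha> * (2 * ((z - a) \<bullet> (p - a)))" .
  then have fin: "\<alpha> * ((dist z p)\<^sup>2 - h\<^sup>2) \<le> r * (dist z a)\<^sup>2"
  proof -
    have "(dist z p)\<^sup>2 - h\<^sup>2 = (dist z a)\<^sup>2 - 2 * ((z - a) \<bullet> (p - a))"
      using dist_sq_expand[of z p a] p(1) by (simp add: dist_commute)
    then have "\<alpha> * ((dist z p)\<^sup>2 - h\<^sup>2) = \<alpha> * (dist z a)\<^sup>2 - \<alpha> * (2 * ((z - a) \<bullet> (p - a)))"
      by (simp only: right_diff_distrib)
    with \<open>(\<alpha> - r) * (dist z a)\<^sup>2 \<le> \<alpha> * _\<close> show ?thesis by (simp only: left_diff_distrib)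
  qed
  also have "\<dots> \<le> 0" using r by (simp add: mult_nonpos_nonneg)
  finally have "(dist z p)\<^sup>2 \<le> h\<^sup>2" using pos by (simp add: mult_le_0_iff)
  then show "dist z p \<le> h" using pos abs_le_square_iff[of "dist z p" h] by simp
  assume "dist z p = h"
  with fin have "0 \<le> r * (dist z a)\<^sup>2" by simp
  then have "z = a \<or> r = 0" using r by (auto simp: zero_le_mult_iff)
  then show "z = a \<or> dist p b = h" using dist_b_P p(1) unfolding P by blast
qed

end

text \<open>As \<theta> is less than a full turn, the parametrization is a homeomorphism from an
  interval, where the claims are evident.\<close>

lemma circ_arc_connected_subset:
  assumes "circ_arc A p q"
  shows "connected A" "p \<in> A" "q \<in> A"
    and "\<And>B. \<lbrakk>B \<subseteq> A; connected B; p \<in> B; q \<in> B\<rbrakk> \<Longrightarrow> B = A"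
proof -
  obtain c r u v \<theta> where r: "r > 0" and uv: "u \<bullet> u = 1" "v \<bullet> v = 1" "u \<bullet> v = 0"
    and th: "0 < \<theta>" "\<theta> < 2 * pi"
    and A: "A = {c + r *\<^sub>R (cos t *\<^sub>R u + sin t *\<^sub>R v) | t. t \<in> {0..\<theta>}}"
    and p: "p = c + r *\<^sub>R u" and q: "q = c + r *\<^sub>R (cos \<theta> *\<^sub>R u + sin \<theta> *\<^sub>R v)"
    using assms unfolding circ_arc_def by blast
  define f where "f t = c + r *\<^sub>R (cos t *\<^sub>R u + sin t *\<^sub>R v)" for t
  have f: "A = f ` {0..\<theta>}" "f 0 = p" "f \<theta> = q"
    using A p q by (auto simp: f_def)
  have cont: "continuous_on {0..\<theta>} f" unfolding f_def by (intro continuous_intros)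
  have inj: "inj_on f {0..\<theta>}"
  proof (rule inj_onI)
    fix s t assume st: "s \<in> {0..\<theta>}" "t \<in> {0..\<theta>}" "f s = f t"
    then have eq: "cos s *\<^sub>R u + sin s *\<^sub>R v = cos t *\<^sub>R u + sin t *\<^sub>R v" using r by (simp add: f_def)
    have "cos s = cos t" using arg_cong[OF eq, of "\<lambda>w. w \<bullet> u"] uv by (simp add: inner_add_left inner_commute[of v u])
    moreover have "sin s = sin t" using arg_cong[OF eq, of "\<lambda>w. w \<bullet> v"] uv by (simp add: inner_add_left)
    ultimately obtain n :: int where n: "s = t + 2 * pi * n" using sin_cos_eq_iff[of s t] by auto
    have "\<bar>s - t\<bar> < 2 * pi" using st th by auto
    then have "\<bar>2 * pi * real_of_int n\<bar> < 2 * pi" using n by simp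
    then have "\<bar>real_of_int n\<bar> < 1" by (simp add: abs_mult)
    then show "s = t" using n by simp
  qed
  show "connected A" unfolding f(1) by (intro connected_continuous_image cont) simp
  show "p \<in> A" "q \<in> A" using f th by force+
  fix B assume B: "B \<subseteq> A" "connected B" "p \<in> B" "q \<in> B"
  let ?g = "inv_into {0..\<theta>} f"
  have "continuous_on A ?g" unfolding f(1) using inv_into_f_f[OF inj] by (intro continuous_on_inv cont) auto
  then have "connected (?g ` B)" using B(1,2) by (intro connected_continuous_image) (auto intro: continuous_on_subset)
  moreover have "0 \<in> ?g ` B" "\<theta> \<in> ?g ` B"
    using B(3,4) inv_into_f_f[OF inj, of 0] inv_into_f_f[OF inj, of \<theta>] th f(2,3) by (force simp: image_iff)+
  ultimately have "{0..\<theta>} \<subseteq> ?g ` B" by (rule connected_contains_Icc)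
  then have "f ` {0..\<theta>} \<subseteq> f ` ?g ` B" by (rule image_mono)
  also have "\<dots> = B"
  proof -
    have "f (?g w) = w" if "w \<in> B" for w using B(1) that unfolding f(1) by (intro f_inv_into_f) auto
    then show ?thesis by (simp add: image_image cong: image_cong)
  qed
  finally show "B = A" using B(1) f(1) by auto
qed

section \<open>Recognizing the edge and its lunes\<close>

context dual_frame begin

lemma continuous_on_P [continuous_intros]:
  "\<lbrakk>continuous_on S f; continuous_on S g; continuous_on S l\<rbrakk> \<Longrightarrow> continuous_on S (\<lambda>z. P (f z) (g z) (l z))"
  unfolding P_def by (intro continuous_intros)

lemma connected_edge: "connected edge"
proof -
  have "edge = (\<lambda>s. P 0 s (k - sqrt (\<beta>\<^sup>2 + k\<^sup>2 - s\<^sup>2))) ` {- \<beta>..\<beta>}"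
  proof (intro equalityI subsetI)
    fix p assume "p \<in> edge"
    then obtain s t where p: "p = P 0 s t" "s\<^sup>2 + (t - k)\<^sup>2 = \<beta>\<^sup>2 + k\<^sup>2" "t \<le> 0" by (auto simp: edge_def)
    have "sqrt (\<beta>\<^sup>2 + k\<^sup>2 - s\<^sup>2) = k - t"
      using p pos by (intro real_sqrt_unique) (auto simp: power2_commute)
    moreover have "k\<^sup>2 \<le> (k - t)\<^sup>2" using p pos by (intro power_mono) auto
    then have "s\<^sup>2 \<le> \<beta>\<^sup>2" using p(2) by (simp add: power2_commute)
    then have "\<bar>s\<bar> \<le> \<beta>" using abs_le_square_iff[of s \<beta>] pos by simp
    ultimately show "p \<in> (\<lambda>s. P 0 s (k - sqrt (\<beta>\<^sup>2 + k\<^sup>2 - s\<^sup>2))) ` {- \<beta>..\<beta>}"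
      using p by (intro image_eqI[of _ _ s]) auto
  next
    fix p assume "p \<in> (\<lambda>s. P 0 s (k - sqrt (\<beta>\<^sup>2 + k\<^sup>2 - s\<^sup>2))) ` {- \<beta>..\<beta>}"
    then obtain s where p: "p = P 0 s (k - sqrt (\<beta>\<^sup>2 + k\<^sup>2 - s\<^sup>2))" and s: "\<bar>s\<bar> \<le> \<beta>" by auto
    have "k\<^sup>2 \<le> \<beta>\<^sup>2 + k\<^sup>2 - s\<^sup>2" using s abs_le_square_iff[of s \<beta>] pos by simp
    then have "k \<le> sqrt (\<beta>\<^sup>2 + k\<^sup>2 - s\<^sup>2)" "(sqrt (\<beta>\<^sup>2 + k\<^sup>2 - s\<^sup>2))\<^sup>2 = \<beta>\<^sup>2 + k\<^sup>2 - s\<^sup>2"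
      using pos by (auto intro!: real_le_rsqrt) (smt (verit) zero_le_power2)
    then show "p \<in> edge" unfolding p edge_def by auto
  qed
  moreover have "connected ((\<lambda>s. P 0 s (k - sqrt (\<beta>\<^sup>2 + k\<^sup>2 - s\<^sup>2))) ` {- \<beta>..\<beta>})"
    by (intro connected_continuous_image continuous_intros) simp
  ultimately show ?thesis by simp
qed

text \<open>The minor arc between \<open>x\<close> and \<open>y\<close> lies in \<open>A\<close> because the antipodes of its points are further than
  \<open>h\<close> from \<open>x\<close>; being connected and containing both ends of \<open>A\<close>, it is all of \<open>A\<close>.\<close>
lemma edge_eqI:
  assumes A: "circ_arc A p q" "{p, q} = {x, y}"
    and sub: "\<And>z. z \<in> A \<Longrightarrow> dist z a = h \<and> dist z b = h \<and> dist z x \<le> h \<and> dist z y \<le> h"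
  shows "A = edge"
proof -
  note arc = circ_arc_connected_subset[OF A(1)]
  have xy: "x \<in> A" "y \<in> A" using arc(2,3) A(2) by auto
  have "edge \<subseteq> A"
  proof
    fix z assume "z \<in> edge"
    then obtain s t where z: "z = P 0 s t" "s\<^sup>2 + (t - k)\<^sup>2 = \<beta>\<^sup>2 + k\<^sup>2" "t \<le> 0" by (auto simp: edge_def)
    have "k\<^sup>2 \<le> (t - k)\<^sup>2" using z pos by (smt (verit) power2_commute power_mono)
    then have "s\<^sup>2 \<le> \<beta>\<^sup>2" using z(2) by simp
    then have s: "\<bar>s\<bar> \<le> \<beta>" using abs_le_square_iff[of s \<beta>] pos by simp
    \<comment> \<open>In the plane of \<open>edge\<close>, \<open>g\<close> vanishes on the line
      through \<open>z\<close> and the centre of the circle. The points \<open>x\<close> and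
      \<open>y\<close> are on opposite closed sides, so \<open>A\<close> meets the line, at
      \<open>z\<close> or at its antipode.\<close>
    define g where "g w = (s *\<^sub>R e3 - (t - k) *\<^sub>R e2) \<bullet> (w - m) - k * s" for w
    have g: "g (P r' s' t') = (t' - k) * s - (t - k) * s'" for r' s' t'
    proof -
      have "s *\<^sub>R e3 - (t - k) *\<^sub>R e2 = 0 *\<^sub>R e1 + (- (t - k)) *\<^sub>R e2 + s *\<^sub>R e3"
        by (simp add: algebra_simps)
      moreover have "P r' s' t' - m = r' *\<^sub>R e1 + s' *\<^sub>R e2 + t' *\<^sub>R e3" by (simp add: P_def)
      ultimately show ?thesis unfolding g_def by (simp only: inner_frame) (simp add: algebra_simps)
    qed
    have "k * \<bar>s\<bar> \<le> (k - t) * \<beta>" using s z pos by (intro mult_mono) auto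
    then have "\<bar>k * s\<bar> \<le> (k - t) * \<beta>" using pos by (simp add: abs_mult)
    then have "g y \<le> 0" "0 \<le> g x" unfolding corners g abs_le_iff by (simp_all add: algebra_simps)
    moreover have "continuous_on A g" unfolding g_def by (intro continuous_intros)
    ultimately obtain w where w: "w \<in> A" "g w = 0"
      using connected_continuous_image[OF _ arc(1), of g] xy
      by (smt (verit, best) connected_iff_interval image_iff imageI)
    obtain r' s' t' where P: "w = P r' s' t'" by (rule P_cases)
    have w': "r' = 0" "s'\<^sup>2 + (t' - k)\<^sup>2 = \<beta>\<^sup>2 + k\<^sup>2" using sub[OF w(1)] dist_corners_edge unfolding P by blast+
    \<comment> \<open>The antipode of \<open>z\<close> has height at least \<open>2 * k\<close>;
      there \<open>dist w x \<le> h\<close> would contradict \<open>k_large\<close>.\<close>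
    have "t' < 2 * k"
    proof (rule ccontr)
      assume "\<not> t' < 2 * k"
      then have "(2 * k)\<^sup>2 \<le> t'\<^sup>2" using pos by (intro power_mono) auto
      then have "4 * k\<^sup>2 \<le> t'\<^sup>2" by (simp add: power_mult_distrib)
      moreover have "(s' - \<beta>)\<^sup>2 + t'\<^sup>2 \<le> h\<^sup>2" using sub[OF w(1)] w' unfolding P corners dist_P_le by simp
      ultimately have "4 * k\<^sup>2 \<le> h\<^sup>2" using zero_le_power2[of "s' - \<beta>"] by linarith
      moreover have "0 < k\<^sup>2" using pos by simp
      ultimately show False using k_large by linarith
    qed
    have "(t' - k) * s = (t - k) * s'" using w(2) unfolding P g by simp
    then have "(t' - k)\<^sup>2 * (s\<^sup>2 + (t - k)\<^sup>2) = (t - k)\<^sup>2 * (s'\<^sup>2 + (t' - k)\<^sup>2)"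
      by (simp add: distrib_left power_mult_distrib[symmetric] mult.commute)
    then have "(t' - k)\<^sup>2 = (t - k)\<^sup>2"
    proof -
      have "0 < k\<^sup>2" using pos by simp
      then have "\<beta>\<^sup>2 + k\<^sup>2 \<noteq> 0" using zero_le_power2[of \<beta>] by linarith
      with \<open>(t' - k)\<^sup>2 * _ = _\<close> show ?thesis unfolding z(2) w'(2) using pos by auto
    qed
    then have "t' - k = t - k \<or> t' - k = k - t" by (auto simp: power2_eq_iff)
    moreover have "t' - k \<noteq> k - t" using z \<open>t' < 2 * k\<close> by auto
    ultimately have t': "t' = t" by auto
    then have "s = s'" using \<open>(t' - k) * s = (t - k) * s'\<close> z pos by auto
    then show "z \<in> A" using w t' w' P z by simp
  qed
  moreover have "p \<in> {x, y}" "q \<in> {x, y}" using A(2) by auto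
  then have "p \<in> edge" "q \<in> edge" using corners_mem by auto
  ultimately show ?thesis using arc(4)[OF _ connected_edge] by simp
qed

definition open_lune :: "pt set" where
  "open_lune = {p. dist p a = h \<and> dist p b \<le> h \<and> side p < 0}"

text \<open>Radial projection from \<open>a\<close>, which inverts \<open>lune_projection\<close>,
  maps a convex piece of the plane of \<open>edge\<close> onto the lune.\<close>

lemma connected_open_lune: "connected open_lune"
proof -
  define W where "W = {w. e1 \<bullet> w = e1 \<bullet> m} \<inter> cball a h \<inter> {w. e3 \<bullet> w < e3 \<bullet> m}"
  have W: "P r s t \<in> W \<longleftrightarrow> r = 0 \<and> t < 0 \<and> dist (P r s t) a \<le> h" for r s t
    using orthonormal by (auto simp: W_def P_def inner_add_right inner_commute dist_commute)
  define f where "f w = a + h *\<^sub>R sgn (w - a)" for w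
  have na: "w \<noteq> a" if "w \<in> W" for w
    using that W[of \<alpha> 0 k] pos by (auto simp: corners)
  have "convex W" unfolding W_def
    by (intro convex_Int convex_hyperplane convex_cball convex_halfspace_lt)
  moreover have "continuous_on W f" unfolding f_def sgn_div_norm using na
    by (intro continuous_intros) auto
  ultimately have "connected (f ` W)" by (intro connected_continuous_image convex_connected)
  moreover have "f ` W = open_lune"
  proof (intro equalityI subsetI)
    fix p assume "p \<in> f ` W"
    then obtain w where w: "w \<in> W" "p = f w" by auto
    obtain r s t where P: "w = P r s t" by (rule P_cases)
    define \<rho> where "\<rho> = h / norm (w - a)"
    have w': "r = 0" "t < 0" "norm (w - a) \<le> h" "norm (w - a) > 0"
      using w(1) na[OF w(1)] unfolding P W by (auto simp: dist_norm)
    have rho: "\<rho> \<ge> 1" using w' by (simp add: \<rho>_def)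
    have pe: "p = a + \<rho> *\<^sub>R (w - a)" by (simp add: w(2) f_def sgn_div_norm \<rho>_def divide_inverse)
    then have d: "dist p a = h" using w' pos by (simp add: dist_norm \<rho>_def)
    have p: "p = P (\<alpha> - \<rho> * \<alpha>) (\<rho> * s) (k + \<rho> * (t - k))"
      unfolding pe P corners P_diff w'(1) by (simp add: P_def algebra_simps)
    have "\<alpha> - \<rho> * \<alpha> \<le> 0" using rho pos by simp
    then have "dist p b \<le> h" using d dist_b_P unfolding p by blast
    moreover have "side p = \<alpha> * \<rho> * t" unfolding p by (simp add: algebra_simps)
    then have "side p < 0" using pos rho w' by (simp add: mult_pos_neg)
    ultimately show "p \<in> open_lune" using d by (simp add: open_lune_def)
  next
    fix p assume p: "p \<in> open_lune"
    obtain r s t where P: "p = P r s t" by (rule P_cases)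
    have d: "dist (P r s t) a = h" "side (P r s t) < 0" "r \<le> 0"
      using p dist_b_P[of r s t] unfolding P open_lune_def by auto
    obtain \<mu> where mu: "0 < \<mu>" "\<mu> \<le> 1"
      "P 0 (\<mu> * s) (k + \<mu> * (t - k)) - a = \<mu> *\<^sub>R (P r s t - a)"
      "(k + \<mu> * (t - k)) * (\<alpha> - r) = side (P r s t)"
      using lune_projection[OF d(1,3)] by blast
    let ?w = "P 0 (\<mu> * s) (k + \<mu> * (t - k))"
    have "norm (?w - a) = \<mu> * h" using mu(1,3) d(1) by (simp add: dist_norm)
    also have "\<dots> \<le> h" using mu pos by simp
    finally have "dist ?w a \<le> h" by (simp add: dist_norm)
    moreover have "(k + \<mu> * (t - k)) * (\<alpha> - r) < 0" using mu(4) d(2) by simp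
    then have "k + \<mu> * (t - k) < 0" using d(3) pos by (simp add: mult_less_0_iff)
    ultimately have "?w \<in> W" unfolding W by simp
    moreover have "p = f ?w"
      unfolding f_def mu(3) P using mu(1) d(1) pos by (simp add: sgn_scaleR) (simp add: sgn_div_norm dist_norm)
    ultimately show "p \<in> f ` W" by (rule image_eqI[rotated])
  qed
  ultimately show ?thesis by simp
qed

text \<open>Being cut off by a ball centred on the dual edge, \<open>q\<close> lies in the lune, so
  \<open>z\<close> is within \<open>h\<close> of it. As \<open>z\<close> is also within
  \<open>h\<close> of \<open>c\<close>, points strictly between \<open>c\<close> and
  \<open>q\<close> are closer than \<open>h\<close> to \<open>z\<close>; hence
  \<open>p = q\<close>.\<close>

lemma thin_region_aux:
  assumes q: "dist q a = h" "dist q b \<le> h" "dist q c > h" and c: "c \<in> dual_edge"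
    and p: "p = c + \<tau> *\<^sub>R (q - c)" "0 < \<tau>" "\<tau> \<le> 1"
    and z: "edge \<subseteq> cball z h" "dist z c \<le> h" "dist z p = h"
  shows "z = a \<or> (dist p a = h \<and> dist p b = h)"
proof -
  have "side q < 0" using dual_edge_dist_le[OF q(1,2) _ c] q(3) by force
  note lune = lune_dist[OF q(1,2) less_imp_le[OF this] z(1)]
  have "\<tau> = 1"
  proof (rule ccontr)
    assume "\<tau> \<noteq> 1"
    then have t: "0 < \<tau>" "\<tau> < 1" using p by auto
    have "(dist q z)\<^sup>2 \<le> h\<^sup>2" "(dist c z)\<^sup>2 \<le> h\<^sup>2"
      using lune(1) z(2) by (auto intro!: power_mono simp: dist_commute)
    then have "(1 - \<tau>) * (dist c z)\<^sup>2 \<le> (1 - \<tau>) * h\<^sup>2" "\<tau> * (dist q z)\<^sup>2 \<le> \<tau> * h\<^sup>2"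
      using t by (auto intro!: mult_left_mono)
    moreover have "h\<^sup>2 = (1 - \<tau>) * (dist c z)\<^sup>2 + \<tau> * (dist q z)\<^sup>2 - \<tau> * (1 - \<tau>) * (dist q c)\<^sup>2"
      using dist_sq_affine[of c \<tau> q z] z(3) p(1) by (simp add: dist_commute)
    moreover have "\<tau> * (1 - \<tau>) * (dist q c)\<^sup>2 > 0"
      using t q(3) pos by (intro mult_pos_pos) auto
    ultimately show False by (simp add: algebra_simps)
  qed
  then have "p = q" using p by simp
  then show ?thesis using lune(2) z(3) q(1) by auto
qed

text \<open>A point of the ball polyhedron cut off by a ball centred on the dual edge is pushed radially
  away from that centre until it hits one of the two lunes.\<close>
lemma thin_region:
  assumes p: "dist p a \<le> h" "dist p b \<le> h" "dist p c > h" and c: "c \<in> dual_edge"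
    and z: "edge \<subseteq> cball z h" "dist z c \<le> h" "dist z p = h"
  shows "z = a \<or> z = b \<or> (dist p a = h \<and> dist p b = h)"
proof -
  define q where "q s = c + s *\<^sub>R (p - c)" for s
  define g where "g s = max (dist (q s) a) (dist (q s) b)" for s
  have pc: "norm (p - c) > h" using p(3) by (simp add: dist_norm)
  have "g 1 \<le> h" using p by (simp add: g_def q_def)
  \<comment> \<open>Large enough for the triangle inequality to put \<open>q N\<close> at distance
    at least \<open>h\<close> from \<open>a\<close>.\<close>
  moreover define N where "N = 1 + (h + dist c a) / norm (p - c)"
  have "h \<le> g N"
  proof -
    have "N * norm (p - c) = norm (p - c) + (h + dist c a)"
    proof -
      have "norm (p - c) \<noteq> 0" using pc pos by linarith
      then show ?thesis unfolding N_def distrib_right by simp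
    qed
    moreover have "N \<ge> 0" using pos by (simp add: N_def)
    ultimately have "dist (q N) c = norm (p - c) + (h + dist c a)"
      by (simp add: q_def dist_norm)
    then have "h \<le> dist (q N) a" using dist_triangle2[of "q N" c a] pc pos by linarith
    then show ?thesis by (simp add: g_def)
  qed
  moreover have "1 \<le> N" using pos pc by (simp add: N_def)
  moreover have "continuous_on {1..N} g" unfolding g_def q_def by (intro continuous_intros)
  ultimately obtain s where s: "1 \<le> s" "g s = h" using IVT'[of g 1 h N] by auto
  have "p = c + (1 / s) *\<^sub>R (q s - c)" "0 < 1 / s" "1 / s \<le> 1"
    using s by (auto simp: q_def)
  note ps = this
  have "1 * norm (p - c) \<le> s * norm (p - c)" using s by (intro mult_right_mono) auto
  then have qc: "dist (q s) c > h" using pc s by (simp add: q_def dist_norm)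
  from s(2) consider "dist (q s) a = h" "dist (q s) b \<le> h" | "dist (q s) b = h" "dist (q s) a \<le> h"
    unfolding g_def by linarith
  then show ?thesis
  proof cases
    case 1
    show ?thesis using thin_region_aux[OF 1 qc c ps z] by blast
  next
    case 2
    show ?thesis
      using dual_frame.thin_region_aux[OF swap_frame 2 qc, unfolded swap_dual_edge swap_edge, OF c ps z] by blast
  qed
qed

end

section \<open>Reuleaux polyhedra\<close>

text \<open>Equal distances to \<open>x\<close> and \<open>y\<close> make \<open>a - m\<close> and
  \<open>b - m\<close> orthogonal to \<open>x - y\<close>; having equal norms, these two vectors
  have orthogonal sum and difference. The bounds on \<open>dist a b\<close> and
  \<open>dist x y\<close> give \<alpha> and \<beta> at most a quarter of h^2 each after squaring,
  which leaves at least half of h^2 for k^2.\<close>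

lemma dual_frame_exists:
  assumes h: "dist a x = h" "dist a y = h" "dist b x = h" "dist b y = h"
    and ne: "a \<noteq> b" "x \<noteq> y" and le: "dist a b \<le> h" "dist x y \<le> h"
  obtains m e1 e2 e3 \<alpha> \<beta> k where "dual_frame a b x y m e1 e2 e3 \<alpha> \<beta> k h"
proof -
  define m where "m = (1/2) *\<^sub>R (x + y)"
  define q where "q = (1/2) *\<^sub>R (x - y)"
  define A B where "A = a - m" and "B = b - m"
  define p r where "p = (1/2) *\<^sub>R (A - B)" and "r = (1/2) *\<^sub>R (A + B)"
  have eqs: "a = m + A" "b = m + B" "A = p + r" "B = r - p"
    by (simp_all add: A_def B_def p_def r_def scaleR_add_right scaleR_diff_right)
  have xy: "x = m + q" "y = m - q"
    by (simp_all add: m_def q_def scaleR_add_right scaleR_diff_right)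
  have orth: "v \<bullet> q = 0 \<and> v \<bullet> v + q \<bullet> q = h\<^sup>2"
    if "dist (m + v) x = h" "dist (m + v) y = h" for v
  proof -
    have "(v - q) \<bullet> (v - q) = h\<^sup>2" "(v + q) \<bullet> (v + q) = h\<^sup>2"
      using that by (simp_all add: xy dist_norm flip: power2_norm_eq_inner)
    then show ?thesis by (simp add: algebra_simps inner_commute)
  qed
  have A: "A \<bullet> q = 0" "A \<bullet> A + q \<bullet> q = h\<^sup>2" and B: "B \<bullet> q = 0" "B \<bullet> B + q \<bullet> q = h\<^sup>2"
    using orth[of A] orth[of B] h by (simp_all add: eqs(1,2)[symmetric])
  have pq: "p \<bullet> q = 0" "r \<bullet> q = 0" using A(1) B(1) by (simp_all add: p_def r_def inner_diff_left inner_add_left)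
  have pr: "p \<bullet> r = 0" using A(2) B(2) by (simp add: p_def r_def algebra_simps inner_commute)
  have sum: "p \<bullet> p + q \<bullet> q + r \<bullet> r = h\<^sup>2"
    using A(2) pr unfolding eqs(3) by (simp add: algebra_simps inner_commute)
  have hp: "h > 0" using le ne by (smt (verit) zero_less_dist_iff)
  have "a - b = 2 *\<^sub>R p" "x - y = 2 *\<^sub>R q" by (simp_all add: eqs(1-2) p_def q_def)
  then have "2 * norm p \<le> h" "2 * norm q \<le> h" using le by (simp_all add: dist_norm)
  then have "(2 * norm p)\<^sup>2 \<le> h\<^sup>2" "(2 * norm q)\<^sup>2 \<le> h\<^sup>2" by - (rule power_mono; simp)+
  then have "4 * (p \<bullet> p) \<le> h\<^sup>2" "4 * (q \<bullet> q) \<le> h\<^sup>2" by (simp_all add: power_mult_distrib power2_norm_eq_inner)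
  then have rr: "h\<^sup>2 \<le> 2 * (r \<bullet> r)" using sum by simp
  then have "r \<bullet> r > 0" using hp by (smt (verit) zero_less_power)
  then have nz: "p \<noteq> 0" "q \<noteq> 0" "r \<noteq> 0" using ne by (auto simp: eqs xy)
  have unit: "sgn v \<bullet> sgn v = 1" if "v \<noteq> 0" for v :: pt
    using that by (simp flip: power2_norm_eq_inner add: norm_sgn)
  have scale: "norm v *\<^sub>R sgn v = v" for v :: pt by (cases "v = 0") (simp_all add: sgn_div_norm)
  have "dual_frame a b x y m (sgn p) (sgn q) (sgn r) (norm p) (norm q) (norm r) h"
  proof
    show "sgn p \<bullet> sgn q = 0" "sgn p \<bullet> sgn r = 0" "sgn q \<bullet> sgn r = 0"
      using pq pr by (simp_all add: sgn_div_norm inner_commute)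
    show "(norm p)\<^sup>2 + (norm q)\<^sup>2 + (norm r)\<^sup>2 = h\<^sup>2" using sum by (simp add: power2_norm_eq_inner)
    show "h\<^sup>2 \<le> 2 * (norm r)\<^sup>2" using rr by (simp add: power2_norm_eq_inner)
  qed (use nz hp unit in \<open>simp_all add: scale eqs xy\<close>)
  then show thesis by (rule that)
qed

text \<open>Pairwise acute, linearly dependent vectors cannot have all coefficients of the same sign,
  so one of them is a nonnegative combination of the others.\<close>
lemma dependent_acute_cone:
  fixes u1 u2 u3 :: "'a::real_inner"
  assumes dep: "r1 *\<^sub>R u1 + r2 *\<^sub>R u2 + r3 *\<^sub>R u3 = 0" "r1 \<noteq> 0 \<or> r2 \<noteq> 0 \<or> r3 \<noteq> 0"
    and acute: "u1 \<bullet> u1 > 0" "u2 \<bullet> u2 > 0" "u3 \<bullet> u3 > 0" "u1 \<bullet> u2 > 0" "u1 \<bullet> u3 > 0" "u2 \<bullet> u3 > 0"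
  obtains "\<exists>\<kappa>\<ge>0. \<exists>\<mu>\<ge>0. u1 = \<kappa> *\<^sub>R u2 + \<mu> *\<^sub>R u3"
    | "\<exists>\<kappa>\<ge>0. \<exists>\<mu>\<ge>0. u2 = \<kappa> *\<^sub>R u1 + \<mu> *\<^sub>R u3"
    | "\<exists>\<kappa>\<ge>0. \<exists>\<mu>\<ge>0. u3 = \<kappa> *\<^sub>R u1 + \<mu> *\<^sub>R u2"
proof -
  have solve: "\<exists>\<kappa>\<ge>0. \<exists>\<mu>\<ge>0. v = \<kappa> *\<^sub>R v' + \<mu> *\<^sub>R v''"
    if eq: "s *\<^sub>R v + s' *\<^sub>R v' + s'' *\<^sub>R v'' = 0" and s: "s \<noteq> 0" "s * s' \<le> 0" "s * s'' \<le> 0"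
    for s s' s'' and v v' v'' :: 'a
  proof (intro exI conjI)
    show "0 \<le> - s' / s" "0 \<le> - s'' / s" using s by (auto simp: mult_le_0_iff divide_le_0_iff)
    have "s *\<^sub>R v = - s' *\<^sub>R v' - s'' *\<^sub>R v''" using eq by (simp add: eq_neg_iff_add_eq_0 algebra_simps)
    then have "(1 / s) *\<^sub>R (s *\<^sub>R v) = (1 / s) *\<^sub>R (- s' *\<^sub>R v' - s'' *\<^sub>R v'')" by simp
    then show "v = (- s' / s) *\<^sub>R v' + (- s'' / s) *\<^sub>R v''" using s by (simp add: scaleR_diff_right)
  qed
  have ip: "r1 * (u1 \<bullet> u1) + r2 * (u1 \<bullet> u2) + r3 * (u1 \<bullet> u3) = 0"
    using arg_cong[OF dep(1), of "\<lambda>w. u1 \<bullet> w"] by (simp add: inner_add_right)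
  have ip2: "r1 * (u1 \<bullet> u2) + r2 * (u2 \<bullet> u2) + r3 * (u2 \<bullet> u3) = 0"
    using arg_cong[OF dep(1), of "\<lambda>w. u2 \<bullet> w"] by (simp add: inner_add_right inner_commute)
  have "\<not> (r1 \<ge> 0 \<and> r2 \<ge> 0 \<and> r3 \<ge> 0)"
  proof
    assume "r1 \<ge> 0 \<and> r2 \<ge> 0 \<and> r3 \<ge> 0"
    then have "0 \<le> r1 * (u1 \<bullet> u1)" "0 \<le> r2 * (u1 \<bullet> u2)" "0 \<le> r3 * (u1 \<bullet> u3)" using acute by auto
    with ip have "r1 * (u1 \<bullet> u1) = 0" "r2 * (u1 \<bullet> u2) = 0" "r3 * (u1 \<bullet> u3) = 0" by linarith+
    then show False using dep(2) acute by auto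
  qed
  moreover have "\<not> (r1 \<le> 0 \<and> r2 \<le> 0 \<and> r3 \<le> 0)"
  proof
    assume "r1 \<le> 0 \<and> r2 \<le> 0 \<and> r3 \<le> 0"
    then have "r1 * (u1 \<bullet> u1) \<le> 0" "r2 * (u1 \<bullet> u2) \<le> 0" "r3 * (u1 \<bullet> u3) \<le> 0"
      using acute by (auto simp: mult_le_0_iff)
    with ip have "r1 * (u1 \<bullet> u1) = 0" "r2 * (u1 \<bullet> u2) = 0" "r3 * (u1 \<bullet> u3) = 0" by linarith+
    then show False using dep(2) acute by auto
  qed
  ultimately consider "r1 \<noteq> 0" "r1 * r2 \<le> 0" "r1 * r3 \<le> 0"
    | "r2 \<noteq> 0" "r2 * r1 \<le> 0" "r2 * r3 \<le> 0" | "r3 \<noteq> 0" "r3 * r1 \<le> 0" "r3 * r2 \<le> 0"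
    unfolding mult_le_0_iff by linarith
  then show thesis
  proof cases
    case 1 then show thesis using solve[OF dep(1)] that(1) by blast
  next
    case 2
    have "r2 *\<^sub>R u2 + r1 *\<^sub>R u1 + r3 *\<^sub>R u3 = 0" using dep(1) by (simp add: algebra_simps)
    then show thesis using solve 2 that(2) by blast
  next
    case 3
    have "r3 *\<^sub>R u3 + r1 *\<^sub>R u1 + r2 *\<^sub>R u2 = 0" using dep(1) by (simp add: algebra_simps)
    then show thesis using solve 3 that(3) by blast
  qed
qed

lemma mem_bface: "z \<in> bface X h a \<longleftrightarrow> dist z a = h \<and> z \<in> bpoly X h"
  by (auto simp: bface_def dist_commute)

lemma edge_set_pair: "edge_set X h {a, b} = bface X h a \<inter> bface X h b"
  by (simp add: edge_set_def)

locale reuleaux =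
  fixes X :: "pt set" and h :: real
  assumes reuleaux: "reuleaux_polyhedron X h"
begin

lemma finite_X: "finite X" and card_X: "3 \<le> card X" and h_pos: "0 < h"
  and irredundant: "c \<in> X \<Longrightarrow> bpoly (X - {c}) h \<noteq> bpoly X h"
  and standard: "standard X h" and vertices_eq: "vertices X h = X"
  using reuleaux by (auto simp: reuleaux_polyhedron_def ball_polyhedron_def)

lemma frontier_body: "frontier (bpoly X h) = {p \<in> bpoly X h. \<exists>c\<in>X. dist c p = h}"
  by (intro frontier_bpoly finite_imp_compact finite_X)

lemma X_subset: "X \<subseteq> bpoly X h"
  using vertices_eq frontier_body unfolding vertices_def by blast

lemma dist_X: "\<lbrakk>c \<in> X; p \<in> bpoly X h\<rbrakk> \<Longrightarrow> dist p c \<le> h"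
  by (metis mem_bpoly dist_commute)

lemma dist_X_X: "\<lbrakk>c \<in> X; c' \<in> X\<rbrakk> \<Longrightarrow> dist c' c \<le> h"
  using X_subset dist_X by blast

text \<open>Otherwise the ball centred at \<open>c\<close> contains the intersection of those centred at \<open>c'\<close> and \<open>c''\<close>.\<close>
lemma no_redundant_cone:
  assumes c: "c \<in> X" "c' \<in> X" "c'' \<in> X" "c' \<noteq> c" "c'' \<noteq> c"
    and d: "dist p c = h" "dist p c' = h" "dist p c'' = h"
  shows "\<not> (\<exists>\<kappa>\<ge>0. \<exists>\<mu>\<ge>0. c - p = \<kappa> *\<^sub>R (c' - p) + \<mu> *\<^sub>R (c'' - p))"
proof
  let ?Z = "bpoly (X - {c}) h"
  assume "\<exists>\<kappa>\<ge>0. \<exists>\<mu>\<ge>0. c - p = \<kappa> *\<^sub>R (c' - p) + \<mu> *\<^sub>R (c'' - p)"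
  then obtain \<kappa> \<mu> where km: "\<kappa> \<ge> 0" "\<mu> \<ge> 0" "c - p = \<kappa> *\<^sub>R (c' - p) + \<mu> *\<^sub>R (c'' - p)" by blast
  have "c' - p \<in> support_cone ?Z h p" "c'' - p \<in> support_cone ?Z h p"
    using c d h_pos by (auto simp: support_cone_iff bpoly_def)
  then have "c - p \<in> support_cone ?Z h p"
    unfolding km(3) using km by (intro support_cone_add support_cone_scale)
  then have "?Z \<subseteq> cball c h" using d h_pos by (simp add: support_cone_iff)
  then have "?Z \<subseteq> bpoly X h" by (auto simp: subset_iff mem_bpoly)
  then show False using irredundant[OF c(1)] bpoly_antimono[of "X - {c}" X h] by auto
qed

text \<open>Independent directions give a vertex by definition. Dependent ones are pairwise acute,
  because the centres are within \<open>h\<close> of each other, so one is in the cone of the other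
  two and its ball would be redundant.\<close>

lemma three_active:
  assumes p: "p \<in> bpoly X h" and c: "c1 \<in> X" "c2 \<in> X" "c3 \<in> X"
    and ne: "c1 \<noteq> c2" "c1 \<noteq> c3" "c2 \<noteq> c3"
    and d: "dist p c1 = h" "dist p c2 = h" "dist p c3 = h"
  shows "p \<in> X"
proof (cases "independent {c1 - p, c2 - p, c3 - p}")
  case True
  have "card {c1 - p, c2 - p, c3 - p} = 3" using ne by simp
  moreover have "p \<in> frontier (bpoly X h)" using p c d by (auto simp: frontier_body dist_commute)
  moreover have "c1 \<in> X \<inter> sphere p h" "c2 \<in> X \<inter> sphere p h" "c3 \<in> X \<inter> sphere p h"
    using c d by auto
  ultimately have "p \<in> vertices X h" unfolding vertices_def using True by blast
  then show ?thesis by (simp add: vertices_eq)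
next
  case False
  have acute: "(c - p) \<bullet> (c' - p) > 0" if "c \<in> X" "c' \<in> X" "dist p c = h" "dist p c' = h" for c c'
  proof -
    have "(dist c c')\<^sup>2 \<le> h\<^sup>2" using dist_X_X that by (intro power_mono) auto
    then have "h\<^sup>2 \<le> 2 * ((c - p) \<bullet> (c' - p))"
      using dist_sq_expand[of c c' p] that by (simp add: dist_commute)
    then show ?thesis using h_pos by (smt (verit) zero_less_power)
  qed
  obtain f where f: "\<exists>v\<in>{c1 - p, c2 - p, c3 - p}. f v \<noteq> 0"
    "(\<Sum>v\<in>{c1 - p, c2 - p, c3 - p}. f v *\<^sub>R v) = 0"
    using False real_vector.dependent_finite[of "{c1 - p, c2 - p, c3 - p}"] by auto
  have "f (c1 - p) *\<^sub>R (c1 - p) + f (c2 - p) *\<^sub>R (c2 - p) + f (c3 - p) *\<^sub>R (c3 - p) = 0"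
    using f(2) ne by (simp add: add.assoc)
  moreover have "f (c1 - p) \<noteq> 0 \<or> f (c2 - p) \<noteq> 0 \<or> f (c3 - p) \<noteq> 0" using f(1) by blast
  ultimately show ?thesis
    by (rule dependent_acute_cone) (use acute c d ne no_redundant_cone in blast)+
qed

text \<open>A common point of two faces that is no vertex leaves only the edge case of
  \<open>standard\<close>.\<close>

lemma edge_label_if:
  assumes "p \<in> bpoly X h" "p \<notin> X" "a \<in> X" "b \<in> X" "a \<noteq> b" "dist p a = h" "dist p b = h"
  shows "{a, b} \<in> edge_labels X h"
proof -
  have "p \<in> bface X h a \<inter> bface X h b" using assms by (simp add: mem_bface)
  moreover have "v \<in> X" if "v \<in> vertices X h" for v using that vertices_eq by simp
  ultimately have "is_edge X h (bface X h a \<inter> bface X h b)"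
    using standard assms(2-5) unfolding standard_def by (metis empty_iff singletonD)
  then show ?thesis using assms unfolding edge_labels_def by blast
qed

lemma is_edge_eq:
  assumes "dual_frame a b x y m e1 e2 e3 \<alpha> \<beta> k h"
    and X: "a \<in> X" "b \<in> X" "x \<in> X" "y \<in> X"
    and e: "is_edge X h (bface X h a \<inter> bface X h b)" "bface X h a \<inter> bface X h b \<inter> X = {x, y}"
  shows "bface X h a \<inter> bface X h b = dual_frame.edge m e1 e2 e3 \<beta> k"
proof -
  obtain p q where "circ_arc (bface X h a \<inter> bface X h b) p q" "{p, q} = {x, y}"
    using e unfolding is_edge_def vertices_eq by metis
  then show ?thesis
    by (rule dual_frame.edge_eqI[OF assms(1)]) (use X dist_X in \<open>auto simp: mem_bface\<close>)
qed

end

locale reuleaux_edge = reuleaux X h + dual_frame a b x y m e1 e2 e3 \<alpha> \<beta> k h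
  for X h a b x y m e1 e2 e3 \<alpha> \<beta> k +
  assumes in_X: "a \<in> X" "b \<in> X" "x \<in> X" "y \<in> X"
    and edge_set_edge: "edge_set X h {a, b} = edge"
    and edge_set_dual: "edge_set X h {x, y} = dual_edge"
    and endpoints_edge: "endpoints X h {a, b} = {x, y}"
    and endpoints_dual: "endpoints X h {x, y} = {a, b}"
begin

lemma swap_reuleaux_edge: "reuleaux_edge X h b a x y m (- e1) e2 e3 \<alpha> \<beta> k"
  using swap_frame reuleaux_axioms in_X edge_set_edge edge_set_dual endpoints_edge endpoints_dual
  by (simp add: reuleaux_edge_def reuleaux_edge_axioms_def swap_edge swap_dual_edge insert_commute)

lemma corners_distinct: "a \<noteq> b" "x \<noteq> y"
  using pos by (auto simp: corners)

end

context reuleaux begin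

text \<open>The faces of \<open>x\<close> and \<open>y\<close> share the two vertices
  \<open>a\<close> and \<open>b\<close>, so by \<open>standard\<close> they meet in an edge: this is
  why every edge has a dual. The choice of \<open>a\<close> in \<open>l\<close> lets a caller look
  from either face.\<close>

lemma edge_label_cases:
  assumes l: "l \<in> edge_labels X h" and a: "a \<in> l"
  obtains b x y m e1 e2 e3 \<alpha> \<beta> k
  where "reuleaux_edge X h a b x y m e1 e2 e3 \<alpha> \<beta> k" "l = {a, b}" "{x, y} \<in> edge_labels X h"
proof -
  obtain b where b: "l = {a, b}" "a \<in> X" "b \<in> X" "a \<noteq> b" and e: "is_edge X h (bface X h a \<inter> bface X h b)"
    using l a unfolding edge_labels_def by (fastforce simp: insert_commute Int_commute)
  obtain x y where xy: "x \<noteq> y" "bface X h a \<inter> bface X h b \<inter> X = {x, y}"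
    using e unfolding is_edge_def vertices_eq by blast
  then have x: "x \<in> X" "y \<in> X" and d: "dist x a = h" "dist x b = h" "dist y a = h" "dist y b = h"
    by (auto simp: mem_bface set_eq_iff)
  obtain m e1 e2 e3 \<alpha> \<beta> k where F: "dual_frame a b x y m e1 e2 e3 \<alpha> \<beta> k h"
    using dual_frame_exists[of a x h y b] d b xy x dist_X_X by (metis dist_commute)
  interpret dual_frame a b x y m e1 e2 e3 \<alpha> \<beta> k h by (rule F)
  have E: "bface X h a \<inter> bface X h b = edge"
    by (rule is_edge_eq[OF F b(2,3) x e xy(2)])
  have ab: "a \<in> bface X h x \<inter> bface X h y" "b \<in> bface X h x \<inter> bface X h y"
    using d b X_subset by (auto simp: mem_bface dist_commute)
  then have e': "is_edge X h (bface X h x \<inter> bface X h y)"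
    using standard x xy(1) b(4) unfolding standard_def by (metis empty_iff singletonD)
  then obtain p q where "bface X h x \<inter> bface X h y \<inter> X = {p, q}"
    unfolding is_edge_def vertices_eq by blast
  moreover have "a \<in> bface X h x \<inter> bface X h y \<inter> X" "b \<in> bface X h x \<inter> bface X h y \<inter> X"
    using ab b by auto
  ultimately have xyab: "bface X h x \<inter> bface X h y \<inter> X = {a, b}" using b(4) by auto
  have D: "bface X h x \<inter> bface X h y = dual_edge"
    using is_edge_eq[OF dual_frame x b(2,3) e' xyab] dual_edge_of_dual by simp
  have "reuleaux_edge X h a b x y m e1 e2 e3 \<alpha> \<beta> k"
    using F reuleaux_axioms b x E D xy(2) xyab
    by (simp add: reuleaux_edge_def reuleaux_edge_axioms_def edge_set_pair endpoints_def vertices_eq)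
  moreover have "{x, y} \<in> edge_labels X h"
    using x xy(1) e' unfolding edge_labels_def by blast
  ultimately show thesis using b(1) that by blast
qed

end

section \<open>The surgery region\<close>

text \<open>The closed sets \<open>L\<close> and \<open>T\<close> make \<open>R\<close> open and
  closed in \<open>S\<close>.\<close>

lemma connected_component_set_eq:
  assumes S: "S \<subseteq> L \<union> T" "S \<inter> L \<inter> T = {}" "S \<inter> L = R"
    and "closed L" "closed T" "connected R" "p \<in> R"
  shows "connected_component_set S p = R"
proof
  let ?Q = "connected_component_set S p"
  have p: "p \<in> S" using S(3) assms(7) by auto
  have Q: "connected ?Q" "?Q \<subseteq> S" "p \<in> ?Q"
    using p by (auto simp: connected_component_subset connected_component_refl)
  have "L \<inter> T \<inter> ?Q = {}" "?Q \<subseteq> L \<union> T" "L \<inter> ?Q \<noteq> {}" using Q S assms(7) by auto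
  then have "T \<inter> ?Q = {}" using connected_closedD[OF Q(1)] assms(4,5) by blast
  then show "?Q \<subseteq> R" using Q(2) S by blast
  show "R \<subseteq> ?Q" using S(3) assms(6,7) by (intro connected_component_maximal) auto
qed

context reuleaux_edge begin

lemma edge_subset: "edge \<subseteq> bpoly X h" and dual_edge_subset: "dual_edge \<subseteq> bpoly X h"
  using edge_set_edge edge_set_dual by (auto simp: edge_set_pair mem_bface)

lemma edge_inter_X: "edge \<inter> X = {x, y}"
  using endpoints_edge by (simp add: endpoints_def edge_set_edge vertices_eq)

lemma lune_in_body:
  assumes "dist p a = h" "dist p b \<le> h" "side p \<le> 0"
  shows "p \<in> bpoly X h" "\<And>c. \<lbrakk>c \<in> X; dist c p = h\<rbrakk> \<Longrightarrow> c = a \<or> dist p b = h"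
proof -
  have "edge \<subseteq> cball c h" if "c \<in> X" for c using edge_subset that by (auto simp: bpoly_def)
  then show "p \<in> bpoly X h" "\<And>c. \<lbrakk>c \<in> X; dist c p = h\<rbrakk> \<Longrightarrow> c = a \<or> dist p b = h"
    using lune_dist[OF assms] by (auto simp: mem_bpoly)
qed

abbreviation side' where "side' \<equiv> dual_frame.side m (- e1) e3 \<alpha> k"

text \<open>\<open>lunes\<close> and \<open>rest\<close> are closed, cover the boundary of the
  polyhedron and overlap only on the two bounding arcs, which is the separation that isolates the
  component.\<close>

abbreviation lunes :: "pt set" where
  "lunes \<equiv> {p. dist p a = h \<and> dist p b \<le> h \<and> side p \<le> 0} \<union> {p. dist p b = h \<and> dist p a \<le> h \<and> side' p \<le> 0}"

abbreviation open_lunes :: "pt set" where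
  "open_lunes \<equiv> {p. dist p a = h \<and> dist p b \<le> h \<and> side p < 0} \<union> {p. dist p b = h \<and> dist p a \<le> h \<and> side' p < 0}"

abbreviation rest :: "pt set" where
  "rest \<equiv> (\<Union>c\<in>X - {a, b}. bface X h c) \<union> {p \<in> bface X h a. 0 \<le> side p} \<union> {p \<in> bface X h b. 0 \<le> side' p}"

lemma side_circle:
  assumes "dist p a = h" "dist p b = h"
  shows "side' p = side p"
proof -
  obtain r s t where P: "p = P r s t" by (rule P_cases)
  have "r = 0" using assms dist_corners_edge unfolding P by blast
  then show ?thesis by (simp add: P swap_side_P)
qed

lemma closed_side: "closed {p. side p \<le> 0}" "closed {p. 0 \<le> side p}"
  unfolding side_def by (auto intro!: closed_Collect_le continuous_intros)

lemma closed_lune: "closed {p. dist p a = h \<and> dist p b \<le> h \<and> side p \<le> 0}"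
  unfolding Collect_conj_eq
  by (intro closed_Int closed_side closed_Collect_le closed_Collect_eq continuous_intros)

lemma closed_bface: "closed (bface X h c)"
  unfolding bface_def by (intro closed_Int closed_bpoly) auto

text \<open>A third face can pass through a lune point only where the face of \<open>b\<close> does
  too. Three active centres then put the point in \<open>X\<close> and on \<open>edge\<close>, so it
  is \<open>x\<close> or \<open>y\<close>, where \<open>side\<close> vanishes.\<close>

lemma lune_meets_rest:
  assumes p: "dist p a = h" "dist p b \<le> h" "side p \<le> 0" and nm: "p \<notin> meridian a"
  shows "side p < 0" "p \<notin> meridian b" "p \<notin> rest" "p \<in> frontier (bpoly X h)"
proof -
  show s: "side p < 0" using p nm meridian_iff_side[OF p(1)] by auto
  note body = lune_in_body[OF p]
  show "p \<notin> meridian b"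
  proof
    assume m: "p \<in> meridian b"
    then have d: "dist p b = h" by (simp add: meridian_def dist_commute)
    then have "side' p = 0"
      using dual_frame.meridian_iff_side[OF swap_frame d] m
        dual_frame.meridian_def[OF swap_frame] meridian_def by simp
    then show False using side_circle[OF p(1) d] s by simp
  qed
  have "False" if c: "c \<in> X" "c \<noteq> a" "c \<noteq> b" "p \<in> bface X h c" for c
  proof -
    have d: "dist p c = h" using c by (simp add: mem_bface)
    then have b: "dist p b = h" using body(2)[of c] c by (simp add: dist_commute)
    then have "p \<in> X" using three_active[OF body(1), of a b c] in_X c p d corners_distinct by auto
    moreover obtain r s t where P: "p = P r s t" by (rule P_cases)
    have "r = 0" using p b dist_corners_edge unfolding P by blast
    then have "t \<le> 0" using s pos unfolding P by (simp add: mult_less_0_iff)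
    then have "p \<in> edge" using p b edge_iff unfolding P by blast
    ultimately have "p = x \<or> p = y" using edge_inter_X by blast
    then show False using s by (auto simp: corners)
  qed
  then show "p \<notin> rest" using s side_circle p by (auto simp: mem_bface)
  show "p \<in> frontier (bpoly X h)" using body(1) p in_X by (auto simp: frontier_body dist_commute)
qed

text \<open>The open lunes are connected and share the inner points of the edge, so all the
  components in the definition coincide with their union.\<close>

lemma surgery_region_eq: "surgery_region X h {a, b} = closure open_lunes"
proof -
  define \<Gamma> where "\<Gamma> = meridian a \<union> meridian b"
  define S where "S = frontier (bpoly X h) - \<Gamma>"
  interpret sw: reuleaux_edge X h b a x y m "- e1" e2 e3 \<alpha> \<beta> k by (rule swap_reuleaux_edge)
  have sw_side: "sw.side' = side"
    by (intro ext) (simp add: side_def dual_frame.side_def[OF sw.swap_frame])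
  have sub: "S \<subseteq> lunes \<union> rest"
  proof
    fix p assume p: "p \<in> S"
    then obtain c where c: "c \<in> X" "dist p c = h" "p \<in> bpoly X h"
      by (auto simp: S_def frontier_body dist_commute)
    then have "dist p a \<le> h" "dist p b \<le> h" using dist_X in_X by auto
    then show "p \<in> lunes \<union> rest" using c
      by (cases "c = a"; cases "c = b") (auto simp: mem_bface not_le)
  qed
  have mer: "\<Union>{minor_arc c h x' y' | c x' y'. c \<in> {a, b} \<and> x' \<in> {x, y} \<and> y' \<in> {x, y} \<and> x' \<noteq> y'} = \<Gamma>"
    using meridian_eq_minor_arc[OF corners_mem(1)] meridian_eq_minor_arc[OF corners_mem(2)]
      corners_distinct minor_arc_commute unfolding \<Gamma>_def by fastforce
  have lune_a: "p \<notin> rest \<and> (p \<in> S \<longrightarrow> side p < 0)"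
    if "dist p a = h" "dist p b \<le> h" "side p \<le> 0" "p \<in> S \<or> side p < 0" for p
  proof -
    have "p \<notin> meridian a" using that meridian_iff_side[of p] by (auto simp: S_def \<Gamma>_def)
    then show ?thesis using lune_meets_rest[OF that(1-3)] by blast
  qed
  have lune_b: "p \<notin> rest \<and> (p \<in> S \<longrightarrow> side' p < 0)"
    if "dist p b = h" "dist p a \<le> h" "side' p \<le> 0" "p \<in> S \<or> side' p < 0" for p
  proof -
    have "p \<notin> meridian b" using that sw.meridian_iff_side[of p] by (auto simp: S_def \<Gamma>_def)
    then show ?thesis using sw.lune_meets_rest[OF that(1-3)] by (auto simp: sw_side)
  qed
  have open_a: "p \<in> S" if "dist p a = h" "dist p b \<le> h" "side p < 0" for p
  proof -
    have "p \<notin> meridian a" using that meridian_iff_side[of p] by auto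
    then show ?thesis using lune_meets_rest[OF that(1,2)] that(3) by (auto simp: S_def \<Gamma>_def)
  qed
  have open_b: "p \<in> S" if "dist p b = h" "dist p a \<le> h" "side' p < 0" for p
  proof -
    have "p \<notin> meridian b" using that sw.meridian_iff_side[of p] by auto
    then show ?thesis using sw.lune_meets_rest[OF that(1,2)] that(3) by (auto simp: S_def \<Gamma>_def)
  qed
  have S_lunes: "S \<inter> lunes = open_lunes"
  proof (intro equalityI subsetI)
    fix p assume "p \<in> S \<inter> lunes"
    then show "p \<in> open_lunes" using lune_a[of p] lune_b[of p] by blast
  next
    fix p assume "p \<in> open_lunes"
    then show "p \<in> S \<inter> lunes" using open_a[of p] open_b[of p] by auto
  qed
  have disj: "S \<inter> lunes \<inter> rest = {}"
    using lune_a lune_b by blast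
  \<comment> \<open>The middle of the edge: a common point that joins the two lunes, and a witness
    that the union over inner edge points is not empty.\<close>
  define z where "z = P 0 0 (k - sqrt (\<beta>\<^sup>2 + k\<^sup>2))"
  have "sqrt (k\<^sup>2) < sqrt (\<beta>\<^sup>2 + k\<^sup>2)" using pos by (intro real_sqrt_less_mono) simp
  then have t: "k - sqrt (\<beta>\<^sup>2 + k\<^sup>2) < 0" using pos by simp
  then have z: "z \<in> edge - {x, y}" using pos by (auto simp: z_def edge_def corners)
  have edge_sub: "p \<in> open_lune \<inter> sw.open_lune" if pe: "p \<in> edge - {x, y}" for p
  proof -
    obtain s t where st: "p = P 0 s t" "s\<^sup>2 + (t - k)\<^sup>2 = \<beta>\<^sup>2 + k\<^sup>2" "t \<le> 0"
      using pe by (auto simp: edge_def)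
    have "t \<noteq> 0" using st pe pos by (auto simp: corners power2_eq_iff)
    moreover have "dist p a = h" "dist p b = h" using st dist_corners_edge by blast+
    ultimately show ?thesis using st pos side_circle[of p]
      by (auto simp: open_lune_def sw.open_lune_def mult_pos_neg)
  qed
  have "open_lunes = open_lune \<union> sw.open_lune"
    by (simp add: open_lune_def sw.open_lune_def)
  then have conn: "connected open_lunes" and "edge - {x, y} \<subseteq> open_lunes"
    using edge_sub z connected_Un[OF connected_open_lune sw.connected_open_lune] by auto
  have "closed lunes" using closed_lune sw.closed_lune by auto
  have "closed rest"
  proof -
    have "closed {p \<in> bface X h a. 0 \<le> side p}" "closed {p \<in> bface X h b. 0 \<le> side' p}"
      using closed_Int[OF closed_bface closed_side(2)] closed_Int[OF closed_bface sw.closed_side(2)]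
      by (simp_all add: Int_def)
    then show ?thesis using finite_X closed_bface by (intro closed_Un closed_UN) auto
  qed
  have cc: "connected_component_set S p = open_lunes" if "p \<in> edge - {x, y}" for p
    by (rule connected_component_set_eq[OF sub disj S_lunes \<open>closed lunes\<close> \<open>closed rest\<close> conn])
      (rule subsetD[OF \<open>edge - {x, y} \<subseteq> open_lunes\<close> that])
  have "\<Union>{connected_component_set S p | p. p \<in> edge - {x, y}} = (\<Union>p\<in>edge - {x, y}. open_lunes)"
    unfolding Setcompr_eq_image by (intro SUP_cong refl cc)
  also have "\<dots> = open_lunes" using z by (intro UN_constant_eq) auto
  finally have "\<Union>{connected_component_set S p | p. p \<in> edge - {x, y}} = open_lunes" .
  then show ?thesis
    by (simp only: surgery_region_def Let_def endpoints_edge edge_set_edge mer S_def[symmetric])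
qed

end

section \<open>The surgered body\<close>

context reuleaux_edge begin

lemma wedge_eq: "wedge X h {a, b} = (\<Union>c\<in>dual_edge. meridian c)"
proof -
  have "\<Union>{minor_arc c h x' y' | c x' y'. c \<in> dual_edge \<and> x' \<in> {x, y} \<and> y' \<in> {x, y} \<and> x' \<noteq> y'}
      = (\<Union>c\<in>dual_edge. minor_arc c h x y)"
    using corners_distinct minor_arc_commute by fastforce
  then show ?thesis
    using meridian_eq_minor_arc by (simp add: wedge_def endpoints_edge edge_set_dual)
qed

lemma meridian_support:
  assumes c: "c \<in> dual_edge" and p: "p \<in> meridian c" and Z: "Z \<subseteq> bpoly X h"
  shows "Z \<subseteq> cball p h"
proof -
  obtain r t where rt: "c = P r 0 t" "r\<^sup>2 + t\<^sup>2 = \<alpha>\<^sup>2 + k\<^sup>2" using c by (auto simp: dual_edge_def)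
  obtain \<kappa> \<mu> where km: "\<kappa> \<ge> 0" "\<mu> \<ge> 0" "p - c = \<kappa> *\<^sub>R (x - c) + \<mu> *\<^sub>R (y - c)"
    using meridian_in_cone[of p r t] p rt by metis
  have "Z \<subseteq> cball x h" "Z \<subseteq> cball y h" using Z in_X by (auto simp: bpoly_def)
  then have "x - c \<in> support_cone Z h c" "y - c \<in> support_cone Z h c"
    using dist_dual_edge[OF rt(2)] h_pos unfolding rt(1) by (simp_all add: support_cone_iff)
  then have "p - c \<in> support_cone Z h c"
    unfolding km(3) using km by (intro support_cone_add support_cone_scale)
  moreover have "dist c p = h" using p by (simp add: meridian_def)
  ultimately show ?thesis using h_pos by (simp add: support_cone_iff)
qed

text \<open>The plane passes through \<open>a\<close>, so the cut is homogeneous in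
  \<open>p - a\<close>, as an argument with cones of directions requires.\<close>

lemma side_centre: "side p = (\<alpha> *\<^sub>R e3 - k *\<^sub>R e1) \<bullet> (p - a)"
proof -
  have "(\<alpha> *\<^sub>R e3 - k *\<^sub>R e1) \<bullet> (a - m) = 0"
    using side_P[of \<alpha> 0 k] by (simp add: corners(1)[symmetric] side_def)
  then show ?thesis unfolding side_def by (simp add: inner_diff_right)
qed

end

locale surgery = reuleaux +
  fixes C :: "pt set set"
  assumes C_subset: "C \<subseteq> edge_labels X h"
    and C_dual: "l \<in> edge_labels X h \<Longrightarrow> l \<in> C \<longleftrightarrow> endpoints X h l \<notin> C"
begin

text \<open>The edges not operated on appear here as the duals of the labels in
  \<open>C\<close>.\<close>

definition centres :: "pt set" where
  "centres = X \<union> (\<Union>l\<in>C. edge_set X h (endpoints X h l))"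

definition body :: "pt set" where
  "body = bpoly centres h"

lemma surgered_edge_cases:
  assumes "l \<in> C" "a \<in> l"
  obtains b x y m e1 e2 e3 \<alpha> \<beta> k
  where "reuleaux_edge X h a b x y m e1 e2 e3 \<alpha> \<beta> k" "l = {a, b}"
    "dual_frame.dual_edge m e1 e2 e3 \<alpha> k \<subseteq> centres"
proof -
  obtain b x y m e1 e2 e3 \<alpha> \<beta> k where F: "reuleaux_edge X h a b x y m e1 e2 e3 \<alpha> \<beta> k" "l = {a, b}"
    by (rule edge_label_cases[OF subsetD[OF C_subset assms(1)] assms(2)]) (rule that)
  interpret reuleaux_edge X h a b x y m e1 e2 e3 \<alpha> \<beta> k by (rule F(1))
  have "dual_edge \<subseteq> centres"
    using assms(1) edge_set_dual endpoints_edge unfolding centres_def F(2) by force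
  then show thesis by (rule that[OF F])
qed

lemma label_nonempty: "l \<in> C \<Longrightarrow> \<exists>a. a \<in> l"
  using C_subset by (auto simp: edge_labels_def)

lemma X_centres: "X \<subseteq> centres"
  by (simp add: centres_def)

lemma body_subset: "body \<subseteq> bpoly X h"
  unfolding body_def by (rule bpoly_antimono[OF X_centres])

lemma centres_subset: "centres \<subseteq> bpoly X h"
proof
  fix e assume "e \<in> centres"
  then consider "e \<in> X" | l where "l \<in> C" "e \<in> edge_set X h (endpoints X h l)"
    by (auto simp: centres_def)
  then show "e \<in> bpoly X h"
  proof cases
    case 1 then show ?thesis using X_subset by blast
  next
    case (2 l)
    then obtain a where "a \<in> l" using label_nonempty by blast
    with 2 obtain b x y m e1 e2 e3 \<alpha> \<beta> k
      where F: "reuleaux_edge X h a b x y m e1 e2 e3 \<alpha> \<beta> k" "l = {a, b}"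
      using surgered_edge_cases by metis
    interpret reuleaux_edge X h a b x y m e1 e2 e3 \<alpha> \<beta> k by (rule F(1))
    show ?thesis using 2 dual_edge_subset by (auto simp: F(2) endpoints_edge edge_set_dual)
  qed
qed

lemma compact_centres: "compact centres"
proof -
  have "finite C" using finite_X C_subset
    by (intro finite_subset[of C "Pow X"]) (auto simp: edge_labels_def)
  moreover have "closed (edge_set X h l)" for l
    unfolding edge_set_def bface_def by (intro closed_INT ballI closed_Int closed_bpoly) auto
  ultimately have "closed centres" unfolding centres_def
    using finite_X by (intro closed_Un closed_UN finite_imp_closed) auto
  moreover have "X \<noteq> {}" using card_X by auto
  then have "bounded centres"
    using centres_subset compact_bpoly[of X h] compact_imp_bounded bounded_subset by blast
  ultimately show ?thesis by (simp add: compact_eq_bounded_closed)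
qed

lemma frontier_surgered_body: "frontier body = {p \<in> body. \<exists>c\<in>centres. dist c p = h}"
  unfolding body_def by (rule frontier_bpoly[OF compact_centres])

text \<open>\<open>e\<close> lies on the faces of both endpoints of the operated edge
  \<open>l\<close>. If \<open>e'\<close> were too far, only the two faces of \<open>l'\<close> could
  be active at \<open>e\<close>; then \<open>l'\<close> is the dual of \<open>l\<close>, although
  both are in \<open>C\<close>.\<close>

lemma dist_centres:
  assumes e: "e \<in> centres" "e' \<in> centres"
  shows "dist e e' \<le> h"
proof (cases "e \<in> X \<or> e' \<in> X")
  case True
  then show ?thesis using e centres_subset dist_X by (metis dist_commute subsetD)
next
  case False
  then obtain l l' where l: "l \<in> C" "e \<in> edge_set X h (endpoints X h l)"
    and l': "l' \<in> C" "e' \<in> edge_set X h (endpoints X h l')"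
    using e by (auto simp: centres_def)
  obtain a0 where a0: "a0 \<in> l" using label_nonempty[OF l(1)] by blast
  obtain b0 x0 y0 m0 f1 f2 f3 \<alpha>0 \<beta>0 k0
    where F0: "reuleaux_edge X h a0 b0 x0 y0 m0 f1 f2 f3 \<alpha>0 \<beta>0 k0" "l = {a0, b0}"
    using surgered_edge_cases[OF l(1) a0] by metis
  interpret F0: reuleaux_edge X h a0 b0 x0 y0 m0 f1 f2 f3 \<alpha>0 \<beta>0 k0 by (rule F0(1))
  obtain a where a: "a \<in> l'" using label_nonempty[OF l'(1)] by blast
  obtain b x y m e1 e2 e3 \<alpha> \<beta> k
    where F: "reuleaux_edge X h a b x y m e1 e2 e3 \<alpha> \<beta> k" "l' = {a, b}"
    using surgered_edge_cases[OF l'(1) a] by metis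
  interpret F: reuleaux_edge X h a b x y m e1 e2 e3 \<alpha> \<beta> k by (rule F(1))
  have ex: "dist e x0 = h" "dist e y0 = h" "e \<in> bpoly X h"
    using l(2) by (simp_all add: F0(2) F0.endpoints_edge edge_set_pair mem_bface)
  have e': "e' \<in> F.dual_edge"
    using l'(2) by (simp add: F(2) F.endpoints_edge F.edge_set_dual)
  show ?thesis
  proof (rule ccontr)
    assume far: "\<not> dist e e' \<le> h"
    have "z \<in> {a, b}" if z: "z \<in> X" "dist e z = h" for z
    proof -
      have "F.edge \<subseteq> cball z h" using F.edge_subset z by (auto simp: bpoly_def)
      moreover have "dist z e' \<le> h" using z centres_subset e(2) dist_X by (metis dist_commute subsetD)
      moreover have "dist e a \<le> h" "dist e b \<le> h" using ex(3) dist_X F.in_X by auto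
      ultimately have "z = a \<or> z = b \<or> (dist e a = h \<and> dist e b = h)"
        using F.thin_region[of e e' z] e' far z by (simp add: dist_commute)
      \<comment> \<open>If \<open>a\<close> and \<open>b\<close> are both active at
        \<open>e\<close>, a third active centre would make \<open>e\<close> a vertex.\<close>
      then show ?thesis
        using three_active[OF ex(3), of a b z] F.in_X z F.corners_distinct False by auto
    qed
    then have "x0 \<in> {a, b}" "y0 \<in> {a, b}" using ex F0.in_X by auto
    then have "{x0, y0} = {a, b}" using F0.corners_distinct by auto
    then have "endpoints X h l = l'" by (simp add: F0(2) F0.endpoints_edge F(2))
    then show False using C_dual[of l] C_subset l(1) l'(1) by auto
  qed
qed

lemma centres_body: "centres \<subseteq> body"
  using dist_centres by (auto simp: body_def mem_bpoly)

lemma in_body_if_support: "body \<subseteq> cball p h \<Longrightarrow> p \<in> body"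
  using centres_body by (auto simp: body_def mem_bpoly dist_commute)

lemma wedge_support:
  assumes l: "l \<in> C" and p: "p \<in> wedge X h l"
  shows "body \<subseteq> cball p h" "\<exists>c\<in>centres. dist c p = h"
proof -
  obtain a where "a \<in> l" using label_nonempty[OF l] by blast
  then obtain b x y m e1 e2 e3 \<alpha> \<beta> k
    where F: "reuleaux_edge X h a b x y m e1 e2 e3 \<alpha> \<beta> k" "l = {a, b}"
      "dual_frame.dual_edge m e1 e2 e3 \<alpha> k \<subseteq> centres"
    using surgered_edge_cases[OF l] by metis
  interpret reuleaux_edge X h a b x y m e1 e2 e3 \<alpha> \<beta> k by (rule F(1))
  obtain c where c: "c \<in> dual_edge" "p \<in> meridian c" using p by (auto simp: F(2) wedge_eq)
  show "body \<subseteq> cball p h" by (rule meridian_support[OF c body_subset])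
  show "\<exists>c\<in>centres. dist c p = h" using c F(3) by (auto simp: meridian_def)
qed

text \<open>Condenses all that the face of \<open>a\<close> has to know about the cut at
  \<open>l\<close> into one normal vector, hiding the frame, so that a normal can be chosen for
  every \<open>l\<close> at once.\<close>

lemma cut_normal:
  assumes l: "l \<in> C" "a \<in> l"
  shows "\<exists>n. \<forall>p\<in>bpoly X h. dist p a = h \<longrightarrow>
    (p \<in> body \<longrightarrow> 0 \<le> n \<bullet> (p - a)) \<and> (n \<bullet> (p - a) = 0 \<longrightarrow> p \<in> wedge X h l) \<and>
    (n \<bullet> (p - a) < 0 \<longrightarrow> p \<in> surgery_region X h l) \<and>
    (p \<in> edge_set X h l \<and> 0 \<le> n \<bullet> (p - a) \<longrightarrow> p \<in> X)"
proof -
  obtain b x y m e1 e2 e3 \<alpha> \<beta> k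
    where F: "reuleaux_edge X h a b x y m e1 e2 e3 \<alpha> \<beta> k" "l = {a, b}"
      "dual_frame.dual_edge m e1 e2 e3 \<alpha> k \<subseteq> centres"
    using surgered_edge_cases[OF l] by metis
  interpret reuleaux_edge X h a b x y m e1 e2 e3 \<alpha> \<beta> k by (rule F(1))
  show ?thesis
  proof (intro exI[of _ "\<alpha> *\<^sub>R e3 - k *\<^sub>R e1"] ballI impI, unfold side_centre[symmetric], intro conjI impI)
    fix p assume p: "p \<in> bpoly X h" "dist p a = h"
    have b: "dist p b \<le> h" using p dist_X in_X by auto
    show "0 \<le> side p" if "p \<in> body"
    proof (rule side_nonneg[OF _ p(2)])
      fix c assume "c \<in> dual_edge"
      then show "dist p c \<le> h" using that F(3) by (auto simp: body_def mem_bpoly dist_commute)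
    qed
    show "p \<in> wedge X h l" if "side p = 0"
      using meridian_iff_side[OF p(2)] b that corners_mem(1) by (auto simp: F(2) wedge_eq)
    show "p \<in> surgery_region X h l" if "side p < 0"
      unfolding F(2) surgery_region_eq using p(2) b that by (intro subsetD[OF closure_subset]) auto
    show "p \<in> X" if "p \<in> edge_set X h l \<and> 0 \<le> side p"
    proof -
      have "p \<in> edge" using that by (simp add: F(2) edge_set_edge)
      then obtain s t where st: "p = P 0 s t" "s\<^sup>2 + (t - k)\<^sup>2 = \<beta>\<^sup>2 + k\<^sup>2" "t \<le> 0" by (auto simp: edge_def)
      then have "t = 0" using that pos by (auto simp: zero_le_mult_iff)
      then have "p = x \<or> p = y" using st by (auto simp: corners power2_eq_iff)
      then show ?thesis using in_X by blast
    qed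
  qed
qed

text \<open>The closed region satisfies \<open>side p \<le> 0\<close> and the body the reverse, so
  they meet on a bounding arc.\<close>

lemma region_in_body:
  assumes l: "l \<in> C" and p: "p \<in> surgery_region X h l" "p \<in> body"
  shows "p \<in> wedge X h l"
proof -
  have lune: "p \<in> wedge X h {a, b}"
    if F: "reuleaux_edge X h a b x y m e1 e2 e3 \<alpha> \<beta> k" "dual_frame.dual_edge m e1 e2 e3 \<alpha> k \<subseteq> centres"
      and d: "dist p a = h" "dist p b \<le> h" "dual_frame.side m e1 e3 \<alpha> k p \<le> 0"
    for a b x y m e1 e2 e3 \<alpha> \<beta> k
  proof -
    interpret reuleaux_edge X h a b x y m e1 e2 e3 \<alpha> \<beta> k by (rule F(1))
    have "0 \<le> side p"
    proof (rule side_nonneg[OF _ d(1)])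
      fix c assume "c \<in> dual_edge"
      then show "dist p c \<le> h" using p(2) F(2) by (auto simp: body_def mem_bpoly dist_commute)
    qed
    then show ?thesis using d meridian_iff_side[OF d(1)] corners_mem(1) by (auto simp: wedge_eq)
  qed
  obtain a where "a \<in> l" using label_nonempty[OF l] by blast
  then obtain b x y m e1 e2 e3 \<alpha> \<beta> k
    where F: "reuleaux_edge X h a b x y m e1 e2 e3 \<alpha> \<beta> k" "l = {a, b}"
      "dual_frame.dual_edge m e1 e2 e3 \<alpha> k \<subseteq> centres"
    using surgered_edge_cases[OF l] by metis
  interpret reuleaux_edge X h a b x y m e1 e2 e3 \<alpha> \<beta> k by (rule F(1))
  have "closed lunes"
    using closed_lune reuleaux_edge.closed_lune[OF swap_reuleaux_edge] by auto
  moreover have "open_lunes \<subseteq> lunes" by auto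
  ultimately have "closure open_lunes \<subseteq> lunes" by (rule closure_minimal[rotated])
  then have "p \<in> lunes" using p(1) unfolding F(2) surgery_region_eq by blast
  then show ?thesis
    using lune[OF F(1,3)] lune[OF swap_reuleaux_edge] F(3) swap_dual_edge
    by (auto simp: F(2) insert_commute)
qed

end

section \<open>Supporting the points of a face along lines of directions\<close>

lemma exists_orthogonal:
  fixes n :: pt
  obtains d where "d \<noteq> 0" "d \<bullet> n = 0"
proof -
  have "2 \<le> DIM(pt)" by simp
  then obtain d :: pt where "d \<noteq> 0" "orthogonal n d" using orthogonal_to_vector_exists by metis
  then show thesis using that by (simp add: orthogonal_def inner_commute)
qed

lemma dist_le_support_iff:
  assumes "h > 0" "v \<noteq> 0" and p: "p = a + (h / norm v) *\<^sub>R v"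
  shows "dist p c \<le> h \<longleftrightarrow> norm v * (dist c a)\<^sup>2 \<le> 2 * h * ((c - a) \<bullet> v)"
    and "dist p c = h \<longleftrightarrow> norm v * (dist c a)\<^sup>2 = 2 * h * ((c - a) \<bullet> v)"
proof -
  define D where "D = norm v * (dist c a)\<^sup>2 - 2 * h * ((c - a) \<bullet> v)"
  have "dist a p = h" using assms by (simp add: dist_norm)
  then have "(dist c p)\<^sup>2 = (dist c a)\<^sup>2 - 2 * ((h / norm v) * ((c - a) \<bullet> v)) + h\<^sup>2"
    using dist_sq_expand[of c p a] by (simp add: p)
  then have "norm v * ((dist p c)\<^sup>2 - h\<^sup>2) = D"
    using assms(2) by (simp add: D_def dist_commute right_diff_distrib)
  moreover have "norm v > 0" using assms(2) by simp
  ultimately have "(dist p c)\<^sup>2 \<le> h\<^sup>2 \<longleftrightarrow> D \<le> 0" "(dist p c)\<^sup>2 = h\<^sup>2 \<longleftrightarrow> D = 0"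
    by (auto simp: mult_le_0_iff)
  then show "dist p c \<le> h \<longleftrightarrow> norm v * (dist c a)\<^sup>2 \<le> 2 * h * ((c - a) \<bullet> v)"
    "dist p c = h \<longleftrightarrow> norm v * (dist c a)\<^sup>2 = 2 * h * ((c - a) \<bullet> v)"
    using assms(1) abs_le_square_iff[of "dist p c" h] power2_eq_iff_nonneg[of "dist p c" h]
    by (auto simp: D_def)
qed

context surgery begin

text \<open>Follow the line until the first constraint becomes active. If it comes from a face, the point
  lies on an edge that is not operated on; if it comes from a cut \<open>n l\<close>, the point lies on a wedge.\<close>
lemma support_cone_along_line:
  fixes n :: "pt set \<Rightarrow> pt"
  assumes a: "a \<in> X" and b: "b \<in> X" "b \<noteq> a" and d: "d \<noteq> 0" "d \<bullet> (b - a) = 0"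
    and n: "\<And>l p. \<lbrakk>l \<in> C; a \<in> l; p \<in> bpoly X h; dist p a = h\<rbrakk> \<Longrightarrow>
      (n l \<bullet> (p - a) = 0 \<longrightarrow> p \<in> wedge X h l) \<and>
      (p \<in> edge_set X h l \<and> 0 \<le> n l \<bullet> (p - a) \<longrightarrow> p \<in> X)"
    and v: "\<And>c. c \<in> X - {a} \<Longrightarrow> norm v * (dist c a)\<^sup>2 \<le> 2 * h * ((c - a) \<bullet> v)"
      "\<And>l. \<lbrakk>l \<in> C; a \<in> l\<rbrakk> \<Longrightarrow> 0 \<le> n l \<bullet> v" "v \<bullet> (b - a) > 0"
  shows "\<exists>s\<ge>0. v + s *\<^sub>R d \<in> support_cone body h a"
proof -
  define f where "f c s = 2 * h * ((c - a) \<bullet> (v + s *\<^sub>R d)) - norm (v + s *\<^sub>R d) * (dist c a)\<^sup>2" for c s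
  define g where "g l s = n l \<bullet> (v + s *\<^sub>R d)" for l s
  define L where "L = {l \<in> C. a \<in> l}"
  have finL: "finite L" using finite_X C_subset
    by (intro finite_subset[of L "Pow X"]) (auto simp: edge_labels_def L_def)
  define S where "S = {s. 0 \<le> s} \<inter> (\<Inter>c\<in>X - {a}. {s. 0 \<le> f c s}) \<inter> (\<Inter>l\<in>L. {s. 0 \<le> g l s})"
  have cf: "continuous_on UNIV (f c)" and cg: "continuous_on UNIV (g l)" for c l
    unfolding f_def g_def by (intro continuous_intros)+
  have "closed S" unfolding S_def
    by (intro closed_Int closed_INT ballI closed_Collect_le continuous_on_const continuous_on_id cf cg)
  \<comment> \<open>Since \<open>d\<close> is orthogonal to \<open>b - a\<close>, the bound imposed
    by \<open>b\<close> on the norm of \<open>v + s *\<^sub>R d\<close> is constant, while the norm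
    grows with \<open>s\<close>.\<close>
  moreover have "bounded S"
  proof -
    define D where "D = (dist b a)\<^sup>2"
    have D: "D > 0" using b by (simp add: D_def)
    have "norm s \<le> (2 * h * (v \<bullet> (b - a)) / D + norm v) / norm d" if "s \<in> S" for s
    proof -
      have s: "0 \<le> s" "0 \<le> f b s" using that b by (auto simp: S_def)
      have "(b - a) \<bullet> (v + s *\<^sub>R d) = v \<bullet> (b - a)"
        using d by (simp add: inner_add_right inner_commute)
      then have "norm (v + s *\<^sub>R d) * D \<le> 2 * h * (v \<bullet> (b - a))" using s by (simp add: f_def D_def)
      then have "norm (v + s *\<^sub>R d) \<le> 2 * h * (v \<bullet> (b - a)) / D" using D by (simp add: field_simps)
      moreover have "s * norm d \<le> norm (v + s *\<^sub>R d) + norm v"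
        using norm_triangle_ineq4[of "v + s *\<^sub>R d" v] s by simp
      ultimately have "s * norm d \<le> 2 * h * (v \<bullet> (b - a)) / D + norm v" by linarith
      then show ?thesis using s d by (simp add: pos_le_divide_eq)
    qed
    then show ?thesis unfolding bounded_iff by blast
  qed
  moreover have "0 \<in> S" using v by (auto simp: S_def f_def g_def L_def)
  ultimately obtain s where s: "s \<in> S" "\<And>t. t \<in> S \<Longrightarrow> t \<le> s"
    using compact_attains_sup[of S] by (auto simp: compact_eq_bounded_closed)
  have s0: "0 \<le> s" using s by (simp add: S_def)
  define w where "w = v + s *\<^sub>R d"
  have wb: "w \<bullet> (b - a) = v \<bullet> (b - a)" using d by (simp add: w_def inner_add_left)
  then have w0: "w \<noteq> 0" using v(3) by auto
  define p where "p = a + (h / norm w) *\<^sub>R w"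
  have pa: "dist p a = h" using w0 h_pos by (simp add: p_def dist_norm)
  note sup = dist_le_support_iff[OF h_pos w0 p_def]
  have pX: "p \<in> bpoly X h"
  proof -
    have "dist c p \<le> h" if "c \<in> X" for c
    proof (cases "c = a")
      case True then show ?thesis using pa by (simp add: dist_commute)
    next
      case False
      then have "0 \<le> f c s" using s(1) that by (simp add: S_def)
      then show ?thesis using sup(1)[of c] by (simp add: f_def w_def dist_commute)
    qed
    then show ?thesis by (simp add: mem_bpoly)
  qed
  have scale: "p - a = (h / norm w) *\<^sub>R w" "w = (norm w / h) *\<^sub>R (p - a)"
    using w0 h_pos by (simp_all add: p_def)
  have gp: "n l \<bullet> (p - a) = (h / norm w) * g l s" for l
    by (simp add: scale(1) g_def w_def)
  have "body \<subseteq> cball p h"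
  proof (cases "p \<in> centres")
    case True
    then show ?thesis by (auto simp: body_def bpoly_def)
  next
    case False
    then have "p \<notin> X" using X_centres by blast
    \<comment> \<open>If every cut is strict, so is every face constraint: a point on a second face
      is on an edge, which consists of centres if not operated on, and otherwise has only vertices
      on this side of the cut.\<close>
    have "\<exists>l\<in>L. g l s = 0"
    proof (rule ccontr)
      assume "\<not> ?thesis"
      then have gpos: "\<forall>l\<in>L. g l s > 0" using s(1) by (force simp: S_def)
      have fpos: "\<forall>c\<in>X - {a}. f c s > 0"
      proof
        fix c assume c: "c \<in> X - {a}"
        have "f c s \<noteq> 0"
        proof
          assume "f c s = 0"
          then have pc: "dist p c = h" using sup(2)[of c] by (simp add: f_def w_def)
          have lab: "{a, c} \<in> edge_labels X h"
            using edge_label_if[OF pX \<open>p \<notin> X\<close> a _ _ pa pc] c by auto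
          have pe: "p \<in> edge_set X h {a, c}" using pX pa pc by (simp add: edge_set_pair mem_bface)
          show False
          proof (cases "{a, c} \<in> C")
            case True
            then have "0 \<le> g {a, c} s" using gpos by (auto simp: L_def intro: less_imp_le)
            then have "0 \<le> n {a, c} \<bullet> (p - a)" using h_pos by (simp add: gp)
            then show False using n[of "{a, c}" p] True pX pa pe \<open>p \<notin> X\<close> by blast
          next
            case notC: False
            obtain b' x y m e1 e2 e3 \<alpha> \<beta> k where F: "reuleaux_edge X h a b' x y m e1 e2 e3 \<alpha> \<beta> k"
              "{a, c} = {a, b'}"
              by (rule edge_label_cases[OF lab, of a]) (rule insertI1, rule that)
            interpret reuleaux_edge X h a b' x y m e1 e2 e3 \<alpha> \<beta> k by (rule F(1))
            have "{x, y} \<in> C" using C_dual[OF lab] notC by (simp add: F(2) endpoints_edge)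
            moreover have "edge_set X h (endpoints X h {x, y}) = edge_set X h {a, c}"
              by (simp add: F(2) endpoints_dual)
            ultimately have "p \<in> centres" using pe unfolding centres_def by blast
            then show False using False by blast
          qed
        qed
        moreover have "0 \<le> f c s" using s(1) c by (simp add: S_def)
        ultimately show "f c s > 0" by simp
      qed
      \<comment> \<open>Finitely many strict constraints persist slightly beyond \<open>s\<close>,
        against maximality.\<close>
      have "\<forall>\<^sub>F t in at_right s. \<forall>c\<in>X - {a}. f c t > 0"
        using fpos finite_X cf
        by (intro eventually_ball_finite ballI order_tendstoD(1))
          (auto simp: continuous_on_def intro: tendsto_within_subset)
      moreover have "\<forall>\<^sub>F t in at_right s. \<forall>l\<in>L. g l t > 0"
        using gpos finL cg
        by (intro eventually_ball_finite ballI order_tendstoD(1))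
          (auto simp: continuous_on_def intro: tendsto_within_subset)
      moreover have "\<forall>\<^sub>F t in at_right s. s < t" by (rule eventually_at_right_less)
      ultimately have "\<forall>\<^sub>F t in at_right s. s < t \<and> t \<in> S"
        by eventually_elim (use s0 in \<open>auto simp: S_def intro: less_imp_le\<close>)
      then obtain t where "s < t" "t \<in> S"
        using eventually_happens' trivial_limit_at_right_real by (metis (no_types, lifting))
      then show False using s(2) by force
    qed
    then obtain l where l: "l \<in> C" "a \<in> l" "g l s = 0" by (auto simp: L_def)
    then have "n l \<bullet> (p - a) = 0" by (simp add: gp)
    then have "p \<in> wedge X h l" using n[OF l(1,2) pX pa] by blast
    then show ?thesis using wedge_support l by blast
  qed
  then have "p - a \<in> support_cone body h a"
    using support_cone_iff[of h a p] h_pos pa by (simp add: dist_commute)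
  then have "w \<in> support_cone body h a"
    using support_cone_scale[of "p - a" body h a "norm w / h"] h_pos scale(2) by simp
  then show ?thesis using s0 w_def by blast
qed

text \<open>The line is followed both ways from \<open>p - a\<close>, which lies between the two
  exits. The alternatives in \<open>out\<close> serve the two inclusions for the boundary: a
  frontier point of the body, or a boundary point outside all removed regions.\<close>

lemma face_support:
  assumes a: "a \<in> X" and p: "p \<in> bpoly X h" "dist p a = h"
    and out: "p \<in> body \<or> (\<forall>l\<in>C. p \<notin> surgery_region X h l)"
  shows "body \<subseteq> cball p h"
proof -
  define good where "good l n \<longleftrightarrow> (\<forall>q\<in>bpoly X h. dist q a = h \<longrightarrow>
    (q \<in> body \<longrightarrow> 0 \<le> n \<bullet> (q - a)) \<and> (n \<bullet> (q - a) = 0 \<longrightarrow> q \<in> wedge X h l) \<and>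
    (n \<bullet> (q - a) < 0 \<longrightarrow> q \<in> surgery_region X h l) \<and>
    (q \<in> edge_set X h l \<and> 0 \<le> n \<bullet> (q - a) \<longrightarrow> q \<in> X))" for l n
  have "\<forall>l\<in>{l \<in> C. a \<in> l}. \<exists>n. good l n" using cut_normal unfolding good_def by blast
  then obtain n where good: "\<forall>l\<in>{l \<in> C. a \<in> l}. good l (n l)" by (rule bchoice[THEN exE])
  have n: "(q \<in> body \<longrightarrow> 0 \<le> n l \<bullet> (q - a)) \<and> (n l \<bullet> (q - a) = 0 \<longrightarrow> q \<in> wedge X h l) \<and>
    (n l \<bullet> (q - a) < 0 \<longrightarrow> q \<in> surgery_region X h l) \<and>
    (q \<in> edge_set X h l \<and> 0 \<le> n l \<bullet> (q - a) \<longrightarrow> q \<in> X)"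
    if "l \<in> C" "a \<in> l" "q \<in> bpoly X h" "dist q a = h" for l q
    using good that unfolding good_def by blast
  have "\<not> X \<subseteq> {a}" using card_X card_mono[of "{a}" X] by auto
  then obtain b where b: "b \<in> X" "b \<noteq> a" by blast
  obtain d where d: "d \<noteq> 0" "d \<bullet> (b - a) = 0" by (rule exists_orthogonal)
  define v where "v = p - a"
  have nv: "norm v = h" using p by (simp add: v_def dist_norm)
  then have v0: "v \<noteq> 0" using h_pos by auto
  have pv: "p = a + (h / norm v) *\<^sub>R v" using nv h_pos by (simp add: v_def)
  have v1: "norm v * (dist c a)\<^sup>2 \<le> 2 * h * ((c - a) \<bullet> v)" if "c \<in> X - {a}" for c
  proof -
    have "dist p c \<le> h" using that dist_X p by blast
    then show ?thesis using dist_le_support_iff(1)[OF h_pos v0 pv] by blast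
  qed
  have v2: "0 \<le> n l \<bullet> v" if "l \<in> C" "a \<in> l" for l
    using n[OF that p] out that(1) unfolding v_def by (meson not_less)
  have "0 < norm v * (dist b a)\<^sup>2" using b nv h_pos by simp
  then have "0 < 2 * h * ((b - a) \<bullet> v)" using v1[of b] b by simp
  then have v3: "0 < v \<bullet> (b - a)" using h_pos by (simp add: zero_less_mult_iff inner_commute)
  have n': "(n l \<bullet> (q - a) = 0 \<longrightarrow> q \<in> wedge X h l) \<and>
      (q \<in> edge_set X h l \<and> 0 \<le> n l \<bullet> (q - a) \<longrightarrow> q \<in> X)"
    if "l \<in> C" "a \<in> l" "q \<in> bpoly X h" "dist q a = h" for l q
    using n[OF that] by blast
  obtain s where s: "s \<ge> 0" "v + s *\<^sub>R d \<in> support_cone body h a"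
    using support_cone_along_line[OF a b d n' v1 v2 v3] by blast
  have d': "- d \<noteq> 0" "- d \<bullet> (b - a) = 0" using d by simp_all
  obtain t where t: "t \<ge> 0" "v + t *\<^sub>R (- d) \<in> support_cone body h a"
    using support_cone_along_line[OF a b d' n' v1 v2 v3] by blast
  have "v \<in> support_cone body h a"
  proof (cases "s + t = 0")
    case True
    then have "s = 0" using s(1) t(1) by linarith
    then show ?thesis using s(2) by simp
  next
    case False
    \<comment> \<open>Weights that cancel \<open>d\<close>.\<close>
    have "(t / (s + t)) *\<^sub>R (v + s *\<^sub>R d) + (s / (s + t)) *\<^sub>R (v + t *\<^sub>R (- d)) \<in> support_cone body h a"
      by (rule support_cone_add[OF support_cone_scale[OF s(2)] support_cone_scale[OF t(2)]])
        (use s t in auto)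
    also have "(t / (s + t)) *\<^sub>R (v + s *\<^sub>R d) + (s / (s + t)) *\<^sub>R (v + t *\<^sub>R (- d))
        = (t / (s + t) + s / (s + t)) *\<^sub>R v"
      by (simp add: algebra_simps)
    also have "t / (s + t) + s / (s + t) = 1" using False by (simp add: add_divide_distrib[symmetric] add.commute)
    finally show ?thesis by simp
  qed
  then show ?thesis
    using support_cone_iff[of h a p] h_pos p by (simp add: v_def dist_commute)
qed

section \<open>The boundary of the surgered body\<close>

lemma frontier_cases:
  assumes "p \<in> frontier body"
  obtains l where "l \<in> C" "p \<in> wedge X h l" | a where "a \<in> X" "dist p a = h"
proof -
  obtain c where c: "p \<in> body" "c \<in> centres" "dist c p = h"
    using assms by (auto simp: frontier_surgered_body)
  show thesis
  proof (cases "c \<in> X")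
    case True
    then show thesis using c that(2) by (simp add: dist_commute)
  next
    case False
    then obtain l where l: "l \<in> C" "c \<in> edge_set X h (endpoints X h l)"
      using c by (auto simp: centres_def)
    obtain a where "a \<in> l" using label_nonempty[OF l(1)] by blast
    then obtain b x y m e1 e2 e3 \<alpha> \<beta> k
      where F: "reuleaux_edge X h a b x y m e1 e2 e3 \<alpha> \<beta> k" "l = {a, b}"
        "dual_frame.dual_edge m e1 e2 e3 \<alpha> k \<subseteq> centres"
      using surgered_edge_cases[OF l(1)] by metis
    interpret reuleaux_edge X h a b x y m e1 e2 e3 \<alpha> \<beta> k by (rule F(1))
    have cd: "c \<in> dual_edge" using l(2) by (simp add: F(2) endpoints_edge edge_set_dual)
    have "p \<in> meridian c"
    proof (rule interior_centre_meridian[OF _ cd])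
      show "dist p c' \<le> h" if "c' \<in> dual_edge" for c'
        using that F(3) c(1) by (auto simp: body_def mem_bpoly dist_commute)
    qed (use False in_X c in \<open>auto simp: dist_commute\<close>)
    then have "p \<in> wedge X h l" using cd by (auto simp: F(2) wedge_eq)
    then show thesis using l that by blast
  qed
qed

lemma frontier_support:
  assumes "p \<in> frontier body"
  shows "body \<subseteq> cball p h"
proof -
  have p: "p \<in> body" using assms by (auto simp: frontier_surgered_body)
  from assms show ?thesis
  proof (cases rule: frontier_cases)
    case (1 l)
    then show ?thesis by (rule wedge_support)
  next
    case (2 a)
    then show ?thesis using face_support p body_subset by blast
  qed
qed

lemma body_nonempty: "body \<noteq> {}"
proof -
  have "X \<noteq> {}" using card_X by auto
  then show ?thesis using X_centres centres_body by blast
qed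

text \<open>Support at frontier points suffices: by symmetry of distance the frontier lies in every
  ball centred in the body, and the body is the convex hull of its frontier.\<close>

lemma body_selfdual: "bpoly body h = body"
proof
  show "bpoly body h \<subseteq> body"
    using bpoly_antimono[OF centres_body, of h] by (simp add: body_def)
  have "compact body" "convex body"
    using X_centres card_X unfolding body_def by (auto intro!: compact_bpoly convex_bpoly)
  then have hull: "body = convex hull (frontier body)" by (intro Krein_Milman_frontier)
  have "body \<subseteq> cball z h" if "z \<in> body" for z
  proof -
    have "frontier body \<subseteq> cball z h" using frontier_support that by (fastforce simp: dist_commute)
    then have "convex hull (frontier body) \<subseteq> cball z h" by (intro hull_minimal) auto
    then show ?thesis using hull by simp
  qed
  then show "body \<subseteq> bpoly body h" by (auto simp: bpoly_def)
qed

text \<open>Off the wedges the active centre of a frontier point is in \<open>X\<close>, and the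
  body meets a removed region only in a wedge. Conversely, each surgered point has the whole body
  within \<open>h\<close>, in particular all centres, so it belongs to the body.\<close>

lemma frontier_eq_surgered: "frontier body = surgered X h C"
proof (intro equalityI subsetI)
  fix p assume fp: "p \<in> frontier body"
  then have p: "p \<in> body" by (auto simp: frontier_surgered_body)
  show "p \<in> surgered X h C"
  proof (cases "\<exists>l\<in>C. p \<in> wedge X h l")
    case True
    then show ?thesis by (auto simp: surgered_def)
  next
    case False
    from fp have "p \<in> frontier (bpoly X h)"
      by (cases rule: frontier_cases) (use False p body_subset in \<open>auto simp: frontier_body dist_commute\<close>)
    then show ?thesis using False region_in_body p by (auto simp: surgered_def)
  qed
next
  fix p assume "p \<in> surgered X h C"
  then consider l where "l \<in> C" "p \<in> wedge X h l"
    | "p \<in> frontier (bpoly X h)" "\<forall>l\<in>C. p \<notin> surgery_region X h l"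
    by (auto simp: surgered_def)
  then show "p \<in> frontier body"
  proof cases
    case 1
    then show ?thesis
      using wedge_support in_body_if_support by (auto simp: frontier_surgered_body)
  next
    case 2
    then obtain a where a: "a \<in> X" "dist a p = h" "p \<in> bpoly X h" by (auto simp: frontier_body)
    then have "body \<subseteq> cball p h" using face_support[of a p] 2 by (simp add: dist_commute)
    then show ?thesis
      using a X_centres in_body_if_support by (auto simp: frontier_surgered_body)
  qed
qed

end

theorem theorem5:
  fixes X :: "(real^3) set" and h :: real and C :: "(real^3) set set"
  assumes "reuleaux_polyhedron X h"
    and "C \<subseteq> edge_labels X h"
    and "\<forall>l\<in>edge_labels X h. (l \<in> C) \<longleftrightarrow> (dual_label X h l \<notin> C)"
  shows "\<exists>K. convex_body K \<and> frontier K = surgered X h C \<and> constant_width K h"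
proof -
  interpret surgery X h C using assms by unfold_locales auto
  show ?thesis
    using constant_width_selfdual[OF body_selfdual body_nonempty h_pos] frontier_eq_surgered by blast
qed

end
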